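(* Let $n\ge 1$. The poset $(\mathcal{M}_n, \leq_{\mathcal{M}})$ is isomorphic to the disjoint union of the posets $(\mathcal{D}_{2n}(\nu), \leq_D)$, each of which is an interval of the Tamari lattice $(\mathcal{D}_{2n},\leq_D)$, over all words $\nu \in \{N,E\}^{n-1}$ that avoid $EE$ (i.e. have no two consecutive letters $E$). The isomorphism is given by $\phi^{-1}$. Furthermore, each connected component of $(\mathcal{M}_n,\leq_{\mathcal{M}})$ consists of exactly all the paths in $\mathcal{M}_n$ of a certain class; that is, the vertex sets of the connected components are exactly the sets of paths in $\mathcal{M}_n$ with a given common value of $\mathrm{cls}$.
   Context: Paths: a Motzkin path is a non-empty lattice path in $\mathbb{Z}^2$ starting at $(0,0)$, ending on the diagonal $y=x$, staying weakly above the diagonal, with steps $N=(0,1)$, $E=(1,0)$, $D=(1,1)$. A Dyck path is a Motzkin path without $D$ steps. The size (length) of a path is its number of steps. Paths are viewed as words in $\{N,E,D\}$. $\mathcal{M}_n$ is the set of Motzkin paths of size $n$, $\mathcal{D}_{2n}$ the set of Dyck paths of size $2n$. Order: a valley of a path $P$ is a lattice point $v$ on $P$ preceded by an $E$ step and followed by an $N$ or $D$ step. Given a valley $v$ of a Motzkin path $P$, let $w$ be the next lattice point on $P$ after $v$ with the same horizontal distance to the diagonal as $v$ (the horizontal distance of $(a,b)$ is $b-a$). Exchanging the sub-path of $P$ between $v$ and $w$ with the $E$ step just before $v$ gives a Motzkin path $Q$; one says $Q$ covers $P$. The order $\leq_{\mathcal{M}}$ on $\mathcal{M}_n$ is the reflexive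 transitive closure of this covering relation. The same procedure applied to Dyck paths in $\mathcal{D}_{2n}$ gives the order $\leq_D$ (the Tamari lattice). Connected components of a poset are those of its Hasse diagram. Class: $\mathrm{cls}(P)$ of a Motzkin path $P$ is the increasing sequence of the heights of its diagonal steps, where the height of a diagonal step is the $y$-coordinate of its end point. Type: for $R\in\mathcal{D}_{2n}$, $\mathrm{Type}(R)$ is the word $w$ of length $n-1$ such that $w_i=N$ if the $i$-th north step of $R$ is immediately followed by an east step, and $w_i=E$ otherwise. $\mathcal{D}_{2n}(\nu)$ is the set of $R\in\mathcal{D}_{2n}$ with $\mathrm{Type}(R)=\nu$, with the order $\leq_D$ restricted to it; it is known (Préville-Ratelle and Viennot) that it is always an interval of the Tamari lattice $(\mathcal{D}_{2n},\leq_D)$. The bijection $\phi$: a Dyck path avoiding three consecutive steps $NNN$ is uniquely written $R = N^{a_1}E^{b_1}\cdots N^{a_k}E^{b_k}$ with $a_i\in\{1,2\}$, $b_i\ge 1$. Set $\xi(1)=D$, $\xi(2)=N$, and $\phi(R)=\xi(a_1)E^{b_1-1}\cdots \xi(a_k)E^{b_k-1}$. This $\phi$ is a bijection from Dyck paths avoiding $NNN$ to Motzkin paths; $\phi^{-1}$ replaces each $D$ by $NE$ and each $N$ by $NNE$. A Dyck path avoids $NNN$ if and only if its type avoids $EE$. *)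

theory Defs
  imports Main "HOL-Library.Sublist"
begin

section \<open>Lattice paths\<close>

datatype step = N | E | D

definition xcoord :: "step list \<Rightarrow> nat" where
  "xcoord W = length (filter (\<lambda>s. s = E \<or> s = D) W)"

definition ycoord :: "step list \<Rightarrow> nat" where
  "ycoord W = length (filter (\<lambda>s. s = N \<or> s = D) W)"

text \<open>Horizontal distance to the diagonal of the end point of \<open>W\<close>, when \<open>W\<close> starts at the
  origin.  The lattice points on a path \<open>P\<close> are the end points of its prefixes.\<close>

definition hdist :: "step list \<Rightarrow> int" where
  "hdist W = int (ycoord W) - int (xcoord W)"

definition motzkin_path :: "step list \<Rightarrow> bool" where
  "motzkin_path P \<longleftrightarrow> P \<noteq> [] \<and> hdist P = 0 \<and> (\<forall>k\<le>length P. hdist (take k P) \<ge> 0)"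

definition dyck_path :: "step list \<Rightarrow> bool" where
  "dyck_path P \<longleftrightarrow> motzkin_path P \<and> D \<notin> set P"

definition motzkin_paths :: "nat \<Rightarrow> step list set" where
  "motzkin_paths n = {P. motzkin_path P \<and> length P = n}"

definition dyck_paths :: "nat \<Rightarrow> step list set" where
  "dyck_paths m = {P. dyck_path P \<and> length P = m}"


section \<open>The rotation order\<close>

text \<open>A pair \<open>(P, Q)\<close> means that \<open>Q\<close> covers \<open>P\<close>.  The valley \<open>v\<close> is the end point of
  \<open>U @ [E]\<close>, and \<open>B\<close> is the sub-path from \<open>v\<close> to the next lattice point \<open>w\<close> with the same
  horizontal distance.\<close>

definition path_cover :: "(step list \<times> step list) set" where
  "path_cover = {(P, Q). \<exists>U B V.
     P = U @ [E] @ B @ V \<and> Q = U @ B @ [E] @ V \<and>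
     B \<noteq> [] \<and> hd B \<in> {N, D} \<and>
     hdist (U @ [E] @ B) = hdist (U @ [E]) \<and>
     (\<forall>k. 0 < k \<and> k < length B \<longrightarrow> hdist (U @ [E] @ take k B) \<noteq> hdist (U @ [E]))}"

definition rotation_order :: "step list set \<Rightarrow> (step list \<times> step list) set" where
  "rotation_order A = Restr ((Restr path_cover A)\<^sup>*) A"

definition motzkin_order :: "nat \<Rightarrow> (step list \<times> step list) set" where
  "motzkin_order n = rotation_order (motzkin_paths n)"

text \<open>The index \<open>m\<close> is the number of steps, so the Tamari lattice on paths with \<open>n\<close> north steps
  is \<open>tamari_order (2 * n)\<close>.\<close>

definition tamari_order :: "nat \<Rightarrow> (step list \<times> step list) set" where
  "tamari_order m = rotation_order (dyck_paths m)"


section \<open>Posets given by a carrier and a relation\<close>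

definition poset_iso ::
  "'a set \<Rightarrow> ('a \<times> 'a) set \<Rightarrow> 'b set \<Rightarrow> ('b \<times> 'b) set \<Rightarrow> ('a \<Rightarrow> 'b) \<Rightarrow> bool" where
  "poset_iso A r B s f \<longleftrightarrow>
     partial_order_on A r \<and> partial_order_on B s \<and> bij_betw f A B \<and>
     (\<forall>x\<in>A. \<forall>y\<in>A. (x, y) \<in> r \<longleftrightarrow> (f x, f y) \<in> s)"

text \<open>The disjoint union of posets \<open>(A i, r i)\<close>, \<open>i \<in> I\<close>, has carrier \<open>Sigma I A\<close>;
  elements with different indices are incomparable.\<close>

definition disjoint_union_order ::
  "'i set \<Rightarrow> ('i \<Rightarrow> ('a \<times> 'a) set) \<Rightarrow> (('i \<times> 'a) \<times> ('i \<times> 'a)) set" where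
  "disjoint_union_order I r = {((i, x), (j, y)). i \<in> I \<and> i = j \<and> (x, y) \<in> r i}"

definition poset_interval :: "'a set \<Rightarrow> ('a \<times> 'a) set \<Rightarrow> 'a set \<Rightarrow> bool" where
  "poset_interval A r S \<longleftrightarrow>
     (\<exists>a\<in>A. \<exists>b\<in>A. (a, b) \<in> r \<and> S = {x \<in> A. (a, x) \<in> r \<and> (x, b) \<in> r})"

definition hasse_diagram :: "'a set \<Rightarrow> ('a \<times> 'a) set \<Rightarrow> ('a \<times> 'a) set" where
  "hasse_diagram A r = {(x, y). x \<in> A \<and> y \<in> A \<and> (x, y) \<in> r \<and> x \<noteq> y \<and>
     \<not> (\<exists>z\<in>A. z \<noteq> x \<and> z \<noteq> y \<and> (x, z) \<in> r \<and> (z, y) \<in> r)}"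

definition connected_components :: "'a set \<Rightarrow> ('a \<times> 'a) set \<Rightarrow> 'a set set" where
  "connected_components A r = A // (hasse_diagram A r \<union> (hasse_diagram A r)\<inverse>)\<^sup>*"


section \<open>Class and type\<close>

text \<open>The heights are listed along the path; as each diagonal step raises the height, this is
  the increasing order.\<close>

definition cls :: "step list \<Rightarrow> nat list" where
  "cls P = map (\<lambda>i. ycoord (take (Suc i) P)) (filter (\<lambda>i. P ! i = D) [0..<length P])"

text \<open>A path in \<open>dyck_paths (2 * n)\<close> has \<open>n\<close> north steps; the last one is discarded, so the type
  has length \<open>n - 1\<close>.\<close>

definition path_type :: "step list \<Rightarrow> step list" where
  "path_type R = map (\<lambda>i. if Suc i < length R \<and> R ! Suc i = E then N else E)
     (butlast (filter (\<lambda>i. R ! i = N) [0..<length R]))"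

definition dyck_paths_of_type :: "nat \<Rightarrow> step list \<Rightarrow> step list set" where
  "dyck_paths_of_type m \<nu> = {R \<in> dyck_paths m. path_type R = \<nu>}"

definition EE_avoiding_words :: "nat \<Rightarrow> step list set" where
  "EE_avoiding_words k = {\<nu>. set \<nu> \<subseteq> {N, E} \<and> length \<nu> = k \<and> \<not> sublist [E, E] \<nu>}"


section \<open>The bijection between NNN-avoiding Dyck paths and Motzkin paths\<close>

definition NNN_avoiding_dyck_paths :: "step list set" where
  "NNN_avoiding_dyck_paths = {R. dyck_path R \<and> \<not> sublist [N, N, N] R}"

definition \<xi> :: "nat \<Rightarrow> step" where
  "\<xi> a = (if a = 1 then D else N)"

text \<open>\<open>run_lengths R\<close> is the list of pairs \<open>(a\<^sub>i, b\<^sub>i)\<close> in the unique decomposition of a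
  Dyck path \<open>R\<close> without three consecutive north steps into \<open>a\<^sub>1\<close> north steps, \<open>b\<^sub>1\<close> east steps,
  \<open>a\<^sub>2\<close> north steps, and so on.  Existence fails for words that have no such decomposition, and
  \<open>run_lengths\<close> and \<open>\<phi>\<close> are then unspecified.\<close>

definition run_lengths :: "step list \<Rightarrow> (nat \<times> nat) list" where
  "run_lengths R = (THE rs. (\<forall>(a, b)\<in>set rs. a \<in> {1, 2} \<and> b \<ge> 1) \<and>
     R = concat (map (\<lambda>(a, b). replicate a N @ replicate b E) rs))"

definition \<phi> :: "step list \<Rightarrow> step list" where
  "\<phi> R = concat (map (\<lambda>(a, b). \<xi> a # replicate (b - 1) E) (run_lengths R))"

definition \<phi>_inv :: "step list \<Rightarrow> step list" where
  "\<phi>_inv = inv_into NNN_avoiding_dyck_paths \<phi>"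

end

theory Submission
  imports Defs
begin

text \<open>The map \<open>\<phi>\<^sup>-\<^sup>1\<close> replaces \<open>N\<close> by \<open>NNE\<close> and \<open>D\<close> by \<open>NE\<close>, so the class of a Motzkin path and the
  type of its image are both determined by, and determine, its subword of non-\<open>E\<close> steps, which
  rotations preserve.  A Tamari rotation either keeps the type or changes one letter from \<open>N\<close> to
  \<open>E\<close>; hence a chain between two Dyck paths of the same type keeps the type throughout, and the
  rotations keeping an \<open>EE\<close>-avoiding type are exactly the images of Motzkin rotations.  Among the
  Motzkin paths with a given subword of non-\<open>E\<close> steps, every path that has a valley can be rotated
  up and every path with an \<open>E\<close> step not directly after an \<open>N\<close> step can be rotated down.  So each
  such set has a greatest and a least element, which makes it connected and its image an
  interval.\<close>

section \<open>Heights\<close>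

lemma hdist_simps [simp]:
  "hdist [] = 0"
  "hdist (N # W) = 1 + hdist W"
  "hdist (E # W) = hdist W - 1"
  "hdist (D # W) = hdist W"
  "hdist (X @ Y) = hdist X + hdist Y"
  by (simp_all add: hdist_def xcoord_def ycoord_def)

lemma hdist_replicate_E [simp]: "hdist (replicate k E) = - int k"
  by (induction k) auto

text \<open>The starting height is a parameter so that the condition splits over concatenation,
  which the quantification over prefixes in \<open>motzkin_path\<close> does not do
  directly.\<close>

primrec stays_above :: "int \<Rightarrow> step list \<Rightarrow> bool" where
  "stays_above h [] \<longleftrightarrow> h \<ge> 0"
| "stays_above h (s # W) \<longleftrightarrow> h \<ge> 0 \<and> stays_above (h + hdist [s]) W"

lemma stays_above_start: "stays_above h W \<Longrightarrow> h \<ge> 0"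
  by (cases W) auto

lemma stays_above_end: "stays_above h W \<Longrightarrow> h + hdist W \<ge> 0"
proof (induction W arbitrary: h)
  case (Cons s W)
  then have "h + hdist [s] + hdist W \<ge> 0" by simp
  then show ?case by (cases s) auto
qed auto

lemma stays_above_append [simp]:
  "stays_above h (X @ Y) \<longleftrightarrow> stays_above h X \<and> stays_above (h + hdist X) Y"
proof (induction X arbitrary: h)
  case Nil
  then show ?case using stays_above_start by auto
next
  case (Cons s X)
  then show ?case by (cases s) (auto simp: algebra_simps)
qed

lemma stays_above_mono: "stays_above h W \<Longrightarrow> h \<le> h' \<Longrightarrow> stays_above h' W"
  by (induction W arbitrary: h h') (force)+

lemma stays_above_iff_take:
  "stays_above h W \<longleftrightarrow> (\<forall>k\<le>length W. h + hdist (take k W) \<ge> 0)"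
proof (induction W arbitrary: h)
  case (Cons s W)
  have "(\<forall>k\<le>length (s # W). h + hdist (take k (s # W)) \<ge> 0) \<longleftrightarrow>
    h \<ge> 0 \<and> (\<forall>k\<le>length W. h + hdist (take (Suc k) (s # W)) \<ge> 0)"
    unfolding less_Suc_eq_le[symmetric] length_Cons
    by (subst All_less_Suc2) simp
  moreover have "hdist (take (Suc k) (s # W)) = hdist [s] + hdist (take k W)" for k
    by (cases s) auto
  ultimately show ?case using Cons.IH by (simp add: add.assoc)
qed auto

lemma motzkin_path_iff: "motzkin_path P \<longleftrightarrow> P \<noteq> [] \<and> hdist P = 0 \<and> stays_above 0 P"
  by (simp add: motzkin_path_def stays_above_iff_take)

text \<open>Cut at the first step that leads below height 0. Only an \<open>E\<close> step descends,
  and by one, so it starts at height exactly 0. This \<open>E\<close> will close the block that an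
  \<open>N\<close> step opens at a valley.\<close>

lemma hdist_first_descent:
  assumes "h \<ge> 0" "h + hdist W < 0"
  shows "\<exists>C V. W = C @ E # V \<and> stays_above h C \<and> h + hdist C = 0"
  using assms
proof (induction W arbitrary: h)
  case (Cons s W)
  show ?case
  proof (cases "h + hdist [s] \<ge> 0")
    case True
    moreover have "h + hdist [s] + hdist W < 0"
      using Cons.prems by (cases s) auto
    ultimately obtain C V where "W = C @ E # V" "stays_above (h + hdist [s]) C"
      "h + hdist [s] + hdist C = 0"
      using Cons.IH by blast
    then show ?thesis using Cons.prems(1)
      by (intro exI[of _ "s # C"] exI[of _ V]) (cases s; auto)
  next
    case False
    then have "s = E \<and> h = 0" using Cons.prems(1) by (cases s) auto
    then show ?thesis by (intro exI[of _ "[]"] exI[of _ W]) auto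
  qed
qed simp

text \<open>Going back from the end, the \<open>N\<close> step that last climbs to the final height
  is found. It opens the block that a downward rotation moves.\<close>

lemma hdist_last_ascent:
  assumes "hdist X > 0"
  shows "\<exists>U C. X = U @ N # C \<and> stays_above 0 C \<and> hdist C = 0"
  using assms
proof (induction X rule: length_induct)
  case (1 X)
  from 1(2) have "X \<noteq> []" by auto
  then obtain X' s where X: "X = X' @ [s]" by (cases X rule: rev_cases) auto
  show ?case
  proof (cases s)
    case N
    then show ?thesis using X by (intro exI[of _ X'] exI[of _ "[]"]) auto
  next
    case E
    then have "hdist X' > 0" "hdist X' > 1" "length X' < length X" using 1(2) X by auto
    then obtain U C where UC: "X' = U @ N # C" "stays_above 0 C" "hdist C = 0"
      using 1(1) by blast
    \<comment> \<open>The first \<open>N\<close> found matches the final \<open>E\<close>. In front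
      of it the height is again that of \<open>X\<close>, so the induction hypothesis applies a
      second time.\<close>
    then have "hdist U > 0" "length U < length X" using \<open>hdist X' > 1\<close> X by auto
    then obtain U2 C2 where "U = U2 @ N # C2" "stays_above 0 C2" "hdist C2 = 0"
      using 1(1) by blast
    then show ?thesis using UC X E stays_above_mono[of 0 C 1]
      by (intro exI[of _ U2] exI[of _ "C2 @ N # C @ [E]"]) auto
  next
    case D
    then have "hdist X' > 0" "length X' < length X" using 1(2) X by auto
    then obtain U C where UC: "X' = U @ N # C" "stays_above 0 C" "hdist C = 0"
      using 1(1) by blast
    then show ?thesis using X D
      by (intro exI[of _ U] exI[of _ "C @ [D]"]) auto
  qed
qed


section \<open>The covering relation\<close>

text \<open>The shape of the block \<open>B\<close> that a rotation moves: a single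
  \<open>D\<close>, or a path that leaves its level by \<open>N\<close> and first returns by
  \<open>E\<close>.\<close>

definition excursion :: "step list \<Rightarrow> bool" where
  "excursion B \<longleftrightarrow> B = [D] \<or> (\<exists>C. B = N # C @ [E] \<and> hdist C = 0 \<and> stays_above 0 C)"

lemma excursion_hdist: "excursion B \<Longrightarrow> hdist B = 0"
  by (auto simp: excursion_def)

lemma excursion_hd: "excursion B \<Longrightarrow> \<exists>s B'. s \<noteq> E \<and> B = s # B'"
  by (auto simp: excursion_def)

lemma stays_above_excursion:
  assumes "excursion B"
  shows "stays_above h B \<longleftrightarrow> h \<ge> 0"
  using assms stays_above_mono[of 0 _ "h + 1"] stays_above_start
  by (auto simp: excursion_def)

lemma excursion_iff:
  "excursion B \<longleftrightarrow> B \<noteq> [] \<and> hd B \<in> {N, D} \<and> hdist B = 0 \<and>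
     (\<forall>k. 0 < k \<and> k < length B \<longrightarrow> hdist (take k B) \<noteq> 0)"
  (is "_ \<longleftrightarrow> ?rhs")
proof
  assume "excursion B"
  then consider "B = [D]" | C where "B = N # C @ [E]" "hdist C = 0" "stays_above 0 C"
    by (auto simp: excursion_def)
  then show ?rhs
  proof cases
    case 2
    have "hdist (take k B) \<noteq> 0" if k: "0 < k" "k < length B" for k
    proof -
      obtain j where j: "k = Suc j" using k by (cases k) auto
      with k 2 have "j \<le> length C" by auto
      then have "take k B = N # take j C" "hdist (take j C) \<ge> 0"
        using 2 j by (auto simp: stays_above_iff_take)
      then show ?thesis by simp
    qed
    then show ?thesis using 2 by auto
  qed auto
next
  assume B: ?rhs
  show "excursion B"
  proof (cases "hd B = D")
    case True
    then obtain B' where B': "B = D # B'" using B by (cases B) auto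
    \<comment> \<open>A \<open>D\<close> step is back at the starting height at once, so nothing can
      follow it.\<close>
    have "hdist (take 1 B) = 0" using B' by simp
    then have "\<not> 1 < length B" using B zero_less_one by blast
    then have "B' = []" using B' by simp
    then show ?thesis using B' by (simp add: excursion_def)
  next
    case False
    then obtain B' where B': "B = N # B'" using B by (cases B) auto
    with B have "B' \<noteq> []" by auto
    then obtain C s where C: "B = N # C @ [s]" using B' by (cases B' rule: rev_cases) auto
    \<comment> \<open>Heights drop by at most one per step and avoid 0 before the end, so they stay
      positive after the initial \<open>N\<close>.\<close>
    have pos: "hdist (N # take k C) > 0" if "k \<le> length C" for k
      using that
    proof (induction k)
      case (Suc k)
      then have "take (Suc k) C = take k C @ [C ! k]" by (simp add: take_Suc_conv_app_nth)
      then have "hdist (N # take (Suc k) C) \<ge> 0"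
        using Suc by (cases "C ! k") auto
      moreover have "take (Suc (Suc k)) B = N # take (Suc k) C" using C Suc by simp
      then have "hdist (N # take (Suc k) C) \<noteq> 0"
        using B[THEN conjunct2, THEN conjunct2, THEN conjunct2, rule_format, of "Suc (Suc k)"]
          C Suc.prems by simp
      ultimately show ?case by linarith
    qed auto
    have "s = E" using pos[of "length C"] C B by (cases s) auto
    moreover have "hdist (take k C) \<ge> 0" if "k \<le> length C" for k
      using pos[OF that] by simp
    then have "stays_above 0 C" by (simp add: stays_above_iff_take)
    ultimately show ?thesis using C B by (auto simp: excursion_def)
  qed
qed

lemma path_cover_iff:
  "(P, Q) \<in> path_cover \<longleftrightarrow>
     (\<exists>U B V. P = U @ [E] @ B @ V \<and> Q = U @ B @ [E] @ V \<and> excursion B)"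
  unfolding path_cover_def excursion_iff by simp

text \<open>Exchanging \<open>E\<close> and \<open>B\<close> shifts only \<open>B\<close>, by one
  level. Its lower level \<open>hdist U - 1\<close> is also the height at which \<open>V\<close>
  starts, so it is nonnegative in both paths.\<close>

lemma path_cover_motzkin_path:
  assumes "(P, Q) \<in> path_cover"
  shows "motzkin_path P \<longleftrightarrow> motzkin_path Q"
proof -
  obtain U B V where UBV: "P = U @ [E] @ B @ V" "Q = U @ B @ [E] @ V" "excursion B"
    using assms path_cover_iff by blast
  then show ?thesis
    using stays_above_start[of "hdist U - 1" V]
    by (auto simp: motzkin_path_iff excursion_hdist stays_above_excursion)
qed

lemma path_cover_length: "(P, Q) \<in> path_cover \<Longrightarrow> length P = length Q"
  by (auto simp: path_cover_iff)

lemma path_cover_motzkin_paths: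
  "(P, Q) \<in> path_cover \<Longrightarrow> P \<in> motzkin_paths n \<longleftrightarrow> Q \<in> motzkin_paths n"
  by (simp add: motzkin_paths_def path_cover_motzkin_path path_cover_length)

text \<open>A rotation replaces the \<open>E\<close> step before the valley by an \<open>N\<close> or \<open>D\<close> step and leaves the
  steps before it alone, so it increases the path lexicographically.\<close>

lemma acyclic_path_cover: "acyclic path_cover"
proof -
  define r where "r = {(E, N), (E, D)}"
  have "path_cover \<subseteq> lexord r"
  proof (clarify)
    fix P Q assume "(P, Q) \<in> path_cover"
    then obtain U B V where "P = U @ [E] @ B @ V" "Q = U @ B @ [E] @ V" "excursion B"
      using path_cover_iff by blast
    moreover from this obtain s B' where "s \<noteq> E" "B = s # B'" using excursion_hd by blast
    ultimately show "(P, Q) \<in> lexord r"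
      by (cases s) (auto simp: r_def lexord_append_leftI)
  qed
  moreover have "acyclic (lexord r)"
  proof -
    have "trans r" "irrefl r" by (auto simp: r_def trans_def irrefl_def)
    then show ?thesis
      by (metis acyclic_irrefl irrefl_def lexord_irreflexive lexord_transI trancl_id)
  qed
  ultimately show ?thesis by (rule acyclic_subset[rotated])
qed

lemma finite_words: "finite {P :: step list. length P = n}"
proof -
  have "UNIV = {N, E, D}" using step.exhaust by auto
  then have "finite (UNIV :: step set)" by (metis finite.emptyI finite.insertI)
  then show ?thesis using finite_lists_length_eq[of UNIV n] by simp
qed

lemma finite_motzkin_paths: "finite (motzkin_paths n)"
  using finite_words[of n] by (rule rev_finite_subset) (auto simp: motzkin_paths_def)

lemma rtrancl_Restr_closed: "(x, y) \<in> (Restr r A)\<^sup>* \<Longrightarrow> x \<in> A \<Longrightarrow> y \<in> A"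
  by (erule rtranclE) auto

lemma partial_order_rotation_order: "partial_order_on A (rotation_order A)"
proof -
  have "acyclic (Restr path_cover A)"
    using acyclic_path_cover by (rule acyclic_subset) auto
  then have "antisym ((Restr path_cover A)\<^sup>*)" by (rule acyclic_impl_antisym_rtrancl)
  then have "antisym (rotation_order A)" by (auto simp: rotation_order_def antisym_def)
  moreover have "trans (rotation_order A)"
    unfolding rotation_order_def by (intro trans_Restr trans_rtrancl)
  ultimately show ?thesis
    by (auto simp: rotation_order_def partial_order_on_def preorder_on_def refl_on_def)
qed

lemma rotation_order_iff:
  "x \<in> A \<Longrightarrow> (x, y) \<in> rotation_order A \<longleftrightarrow> (x, y) \<in> (Restr path_cover A)\<^sup>*"
  by (auto simp: rotation_order_def dest: rtrancl_Restr_closed)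


section \<open>Skeletons\<close>

text \<open>The skeleton (the path without its \<open>E\<close> steps) is the common invariant behind the class
  of a Motzkin path and the type of its image under \<open>\<phi>\<^sup>-\<^sup>1\<close>.\<close>

definition skeleton :: "step list \<Rightarrow> step list" where
  "skeleton P = filter (\<lambda>s. s \<noteq> E) P"

lemma skeleton_simps [simp]:
  "skeleton [] = []"
  "skeleton (N # P) = N # skeleton P"
  "skeleton (D # P) = D # skeleton P"
  "skeleton (E # P) = skeleton P"
  "skeleton (P @ Q) = skeleton P @ skeleton Q"
  "skeleton (skeleton P) = skeleton P"
  by (simp_all add: skeleton_def)

lemma E_notin_skeleton [simp]: "E \<notin> set (skeleton P)"
  by (simp add: skeleton_def)

lemma path_cover_skeleton: "(P, Q) \<in> path_cover \<Longrightarrow> skeleton P = skeleton Q"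
  by (auto simp: path_cover_iff)

lemma rtrancl_path_cover_skeleton:
  "(P, Q) \<in> (Restr path_cover A)\<^sup>* \<Longrightarrow> skeleton P = skeleton Q"
  by (induction rule: rtrancl_induct) (auto dest: path_cover_skeleton)

text \<open>For a Motzkin path of known size the right-hand side depends only on the number of
  \<open>D\<close> steps, which is the length of the class.\<close>

lemma length_skeleton: "2 * int (length (skeleton P)) =
    int (length P) + hdist P + int (length (filter (\<lambda>s. s = D) P))"
proof (induction P)
  case (Cons s P)
  then show ?case by (cases s) auto
qed auto

lemma cls_snoc: "cls (P @ [s]) = cls P @ (if s = D then [Suc (ycoord P)] else [])"
proof -
  have "map (\<lambda>i. ycoord (take (Suc i) (P @ [s]))) (filter (\<lambda>i. (P @ [s]) ! i = D) [0..<length P]) =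
    map (\<lambda>i. ycoord (take (Suc i) P)) (filter (\<lambda>i. P ! i = D) [0..<length P])"
    by (intro map_cong filter_cong) (auto simp: nth_append)
  then show ?thesis by (simp add: cls_def nth_append) (simp add: ycoord_def)
qed

lemma ycoord_eq_length_skeleton: "ycoord P = length (skeleton P)"
proof (induction P)
  case (Cons s P)
  then show ?case by (cases s) (auto simp: ycoord_def)
qed (simp add: ycoord_def)

lemma cls_Nil [simp]: "cls [] = []"
  by (simp add: cls_def)

lemma cls_skeleton: "cls (skeleton P) = cls P"
proof (induction P rule: rev_induct)
  case (snoc s P)
  then show ?case by (cases s) (auto simp: cls_snoc ycoord_eq_length_skeleton)
qed simp

lemma length_cls: "length (cls P) = length (filter (\<lambda>s. s = D) P)"
  by (induction P rule: rev_induct) (auto simp: cls_snoc)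

lemma cls_le_length: "h \<in> set (cls P) \<Longrightarrow> h \<le> length P"
proof (induction P rule: rev_induct)
  case (snoc s P)
  have "ycoord P \<le> length P" by (simp add: ycoord_def)
  with snoc show ?case by (auto simp: cls_snoc split: if_splits)
qed simp

text \<open>Without \<open>E\<close> steps every step raises the height by one, so the class lists
  the positions of the letters \<open>D\<close>, and all other letters are \<open>N\<close>.\<close>

lemma cls_inj_on_skeletons:
  assumes "cls v = cls w" "length v = length w" "skeleton v = v" "skeleton w = w"
  shows "v = w"
  using assms
proof (induction v arbitrary: w rule: rev_induct)
  case (snoc s v)
  then obtain w' t where w: "w = w' @ [t]" by (cases w rule: rev_cases) auto
  have st: "s \<noteq> E" "t \<noteq> E"
    using E_notin_skeleton[of "v @ [s]"] E_notin_skeleton[of "w' @ [t]"]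
    unfolding snoc.prems(3,4)[unfolded w] by auto
  have skel: "skeleton v = v" "skeleton w' = w'"
    using st snoc.prems(3,4) unfolding w by (cases s; cases t; simp)+
  have y: "ycoord v = length v" "ycoord w' = length v"
    using snoc.prems(2) w by (simp_all add: ycoord_eq_length_skeleton skel)
  \<comment> \<open>A final \<open>D\<close> has this height, which is too large for any earlier
    step. So the class shows whether the last letter is \<open>D\<close>.\<close>
  have "Suc (length v) \<notin> set (cls v)" "Suc (length v) \<notin> set (cls w')"
    using cls_le_length[of "Suc (length v)" v] cls_le_length[of "Suc (length v)" w'] snoc.prems(2) w
    by auto
  moreover have "Suc (length v) \<in> set (cls v @ [Suc (length v)])" by simp
  ultimately have "s = t \<and> cls v = cls w'"
    using snoc.prems(1) st y unfolding w
    by (cases s; cases t; simp add: cls_snoc; metis)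
  moreover from this have "v = w'"
    using snoc.IH[of w'] skel snoc.prems(2) w by simp
  ultimately show ?case using w by simp
qed simp

lemma cls_eq_iff_skeleton:
  assumes "P \<in> motzkin_paths n" "Q \<in> motzkin_paths n"
  shows "cls P = cls Q \<longleftrightarrow> skeleton P = skeleton Q"
proof
  assume *: "cls P = cls Q"
  have "length (filter (\<lambda>s. s = D) P) = length (filter (\<lambda>s. s = D) Q)"
    using * length_cls by metis
  then have "2 * int (length (skeleton P)) = 2 * int (length (skeleton Q))"
    unfolding length_skeleton using assms by (simp add: motzkin_paths_def motzkin_path_iff)
  then show "skeleton P = skeleton Q"
    using * cls_inj_on_skeletons[of "skeleton P" "skeleton Q"] by (simp add: cls_skeleton)
qed (metis cls_skeleton)


section \<open>Extremal paths with a given skeleton\<close>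

text \<open>Serves both directions: applied to the rotations it leads to the highest path, applied
  to their converse to the lowest.\<close>

lemma finite_acyclic_reaches_maximal:
  assumes "finite r" "acyclic r"
  shows "\<exists>y. (x, y) \<in> r\<^sup>* \<and> (\<forall>z. (y, z) \<notin> r)"
proof -
  have "wf (r\<inverse>)" using assms by (rule finite_acyclic_wf_converse)
  then show ?thesis
  proof (induction x rule: wf_induct_rule)
    case (less x)
    show ?case
    proof (cases "\<exists>z. (x, z) \<in> r")
      case True
      then obtain z where z: "(x, z) \<in> r" ..
      then obtain y where "(z, y) \<in> r\<^sup>*" "\<forall>u. (y, u) \<notin> r"
        using less.IH[of z] by auto
      then show ?thesis using converse_rtrancl_into_rtrancl[OF z] by auto
    next
      case False
      then show ?thesis by (intro exI[of _ x]) simp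
    qed
  qed
qed

text \<open>Collecting the \<open>E\<close> steps at the end leaves no valley. The conversion by
  \<open>nat\<close> is harmless for a word without \<open>E\<close>, whose height is
  nonnegative.\<close>

definition highest :: "step list \<Rightarrow> step list" where
  "highest w = w @ replicate (nat (hdist w)) E"

primrec lowest :: "step list \<Rightarrow> step list" where
  "lowest [] = []"
| "lowest (s # w) = (if s = N then [N, E] else [s]) @ lowest w"

lemma skeleton_lowest [simp]: "E \<notin> set w \<Longrightarrow> skeleton (lowest w) = w"
proof (induction w)
  case (Cons s w)
  then show ?case by (cases s) auto
qed simp

lemma hdist_lowest [simp]: "E \<notin> set w \<Longrightarrow> hdist (lowest w) = 0"
proof (induction w)
  case (Cons s w)
  then show ?case by (cases s) auto
qed simp

lemma stays_above_lowest [simp]: "E \<notin> set w \<Longrightarrow> stays_above h (lowest w) \<longleftrightarrow> h \<ge> 0"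
proof (induction w arbitrary: h)
  case (Cons s w)
  then show ?case by (cases s) (simp_all, linarith)
qed simp

lemma lowest_Nil_iff [simp]: "lowest w = [] \<longleftrightarrow> w = []"
  by (cases w) auto

lemma motzkin_path_lowest: "E \<notin> set w \<Longrightarrow> w \<noteq> [] \<Longrightarrow> motzkin_path (lowest w)"
  by (simp add: motzkin_path_iff)

text \<open>Without valleys only \<open>E\<close> steps can follow an \<open>E\<close> step, and the
  final height 0 fixes how many there are.\<close>

lemma no_valley_eq_highest:
  assumes "\<And>U s V. P = U @ E # s # V \<Longrightarrow> s = E" "hdist P = 0"
  shows "P = highest (skeleton P)"
proof -
  have "\<exists>k. P = skeleton P @ replicate k E"
    using assms(1)
  proof (induction P)
    case (Cons s P)
    have "\<exists>k. P = skeleton P @ replicate k E"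
      using Cons.prems[of "s # U" for U] by (intro Cons.IH) auto
    then obtain k where k: "P = skeleton P @ replicate k E" ..
    show ?case
    proof (cases "s = E")
      case True
      have "skeleton P = []"
      proof (rule ccontr)
        assume "skeleton P \<noteq> []"
        then obtain t w where tw: "skeleton P = t # w" by (cases "skeleton P") auto
        then have "t \<noteq> E" using E_notin_skeleton[of P] by auto
        moreover have "s # P = [] @ E # t # w @ replicate k E" using k tw True by simp
        ultimately show False using Cons.prems by blast
      qed
      then show ?thesis using k True by (intro exI[of _ "Suc k"]) simp
    next
      case False
      then have "skeleton (s # P) = s # skeleton P" by (cases s) auto
      then show ?thesis using k by (intro exI[of _ k]) simp
    qed
  qed simp
  then obtain k where k: "P = skeleton P @ replicate k E" ..
  have "hdist P = hdist (skeleton P) - int k" by (subst k) simp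
  then show ?thesis using k assms(2) by (simp add: highest_def)
qed

text \<open>Each \<open>N\<close> is followed by at most one \<open>E\<close>, so the height cannot
  be negative, and it is 0 only if each \<open>N\<close> has its \<open>E\<close>. The inequality is
  part of the claim because the induction uses it to exclude an \<open>N\<close> without
  \<open>E\<close>.\<close>

lemma every_E_after_N_eq_lowest:
  assumes "\<And>U s V. P = U @ s # E # V \<Longrightarrow> s = N" "\<And>V. P \<noteq> E # V"
  shows "hdist P \<ge> 0 \<and> (hdist P = 0 \<longrightarrow> P = lowest (skeleton P))"
  using assms
proof (induction P rule: length_induct)
  case (1 P)
  note prems = 1(2,3)
  have IH: "hdist Q \<ge> 0 \<and> (hdist Q = 0 \<longrightarrow> Q = lowest (skeleton Q))"
    if "P = R @ Q" "R \<noteq> []" "\<And>V. Q \<noteq> E # V" for R Q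
  proof -
    have "length Q < length P" using that by auto
    moreover have "s = N" if "Q = U @ s # E # V" for U s V
      using prems(1)[of "R @ U" s V] that \<open>P = R @ Q\<close> by simp
    ultimately show ?thesis using 1(1) that(3) by blast
  qed
  show ?case
  proof (cases P)
    case (Cons s P')
    show ?thesis
    proof (cases s)
      case N
      show ?thesis
      proof (cases "\<exists>Q. P' = E # Q")
        case True
        then obtain Q where Q: "P = [N, E] @ Q" using Cons N by auto
        have "Q \<noteq> E # V" for V using prems(1)[of "[N]" E V] Q by auto
        then show ?thesis using IH[OF Q] Q by simp
      next
        case False
        then have "hdist P' \<ge> 0" using IH[of "[N]" P'] Cons N by auto
        then show ?thesis using Cons N by simp
      qed
    next
      case E
      then show ?thesis using prems(2)[of P'] Cons by simp
    next
      case D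
      then have "P' \<noteq> E # V" for V using prems(1)[of "[]" D V] Cons by auto
      then show ?thesis using IH[of "[D]" P'] Cons D by simp
    qed
  qed simp
qed

text \<open>The path must come down to the diagonal, so an excursion that starts at the valley does
  close.\<close>

lemma motzkin_path_valley_rotates:
  assumes "motzkin_path (U @ E # s # V)" "s \<noteq> E"
  shows "\<exists>Q. (U @ E # s # V, Q) \<in> path_cover"
proof -
  have "\<exists>B W. s # V = B @ W \<and> excursion B"
  proof (cases s)
    case N
    have "stays_above (hdist U - 1) (N # V)" "hdist U - 1 + hdist (N # V) = 0"
      using assms N by (auto simp: motzkin_path_iff)
    then have "hdist V < 0" by auto
    then obtain C W where "V = C @ E # W" "stays_above 0 C" "hdist C = 0"
      using hdist_first_descent[of 0 V] by auto
    then show ?thesis using N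
      by (intro exI[of _ "N # C @ [E]"] exI[of _ W]) (auto simp: excursion_def)
  next
    case D
    then show ?thesis by (intro exI[of _ "[D]"] exI[of _ V]) (auto simp: excursion_def)
  qed (use assms in simp)
  then obtain B W where "s # V = B @ W" "excursion B" by blast
  then show ?thesis by (auto simp: path_cover_iff)
qed

text \<open>A downward rotation needs an excursion that ends just before the \<open>E\<close> step.
  It is the \<open>D\<close> step itself, or runs back from the preceding \<open>E\<close> to its
  matching \<open>N\<close>.\<close>

lemma motzkin_path_rotates_down:
  assumes "motzkin_path (U @ s # E # V)" "s \<noteq> N"
  shows "\<exists>P. (P, U @ s # E # V) \<in> path_cover"
proof -
  have "\<exists>X B. U @ [s] = X @ B \<and> excursion B"
  proof (cases s)
    case E
    have "stays_above (hdist U - 2) V" using assms E by (auto simp: motzkin_path_iff)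
    then have "hdist U > 0" using stays_above_start by fastforce
    then obtain X C where "U = X @ N # C" "stays_above 0 C" "hdist C = 0"
      using hdist_last_ascent by blast
    then show ?thesis using E
      by (intro exI[of _ X] exI[of _ "N # C @ [E]"]) (auto simp: excursion_def)
  next
    case D
    then show ?thesis by (intro exI[of _ U] exI[of _ "[D]"]) (auto simp: excursion_def)
  qed (use assms in simp)
  then obtain X B where XB: "U @ [s] = X @ B" "excursion B" by blast
  then have "U @ s # E # V = X @ B @ [E] @ V"
    by (metis append.assoc append_Cons append_Nil)
  then show ?thesis using XB(2) path_cover_iff by metis
qed

text \<open>Rotating as long as possible ends in a path that cannot be rotated further. Such a path
  is determined by its skeleton, which no rotation changes.\<close>

lemma motzkin_between_extremal:
  assumes "P \<in> motzkin_paths n"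
  shows "(P, highest (skeleton P)) \<in> motzkin_order n"
    and "(lowest (skeleton P), P) \<in> motzkin_order n"
proof -
  let ?r = "Restr path_cover (motzkin_paths n)"
  have fin: "finite ?r" using finite_motzkin_paths by simp
  have acyc: "acyclic ?r" using acyclic_path_cover by (rule acyclic_subset) auto
  obtain Q where Q: "(P, Q) \<in> ?r\<^sup>*" "\<And>R. (Q, R) \<notin> ?r"
    using finite_acyclic_reaches_maximal[OF fin acyc, of P] by metis
  have QM: "Q \<in> motzkin_paths n" using rtrancl_Restr_closed[OF Q(1) assms] .
  have "Q = highest (skeleton Q)"
  proof (rule no_valley_eq_highest)
    show "s = E" if eq: "Q = U @ E # s # V" for U s V
    proof (rule ccontr)
      assume "s \<noteq> E"
      moreover have "motzkin_path (U @ E # s # V)"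
        using QM unfolding eq motzkin_paths_def by blast
      ultimately obtain R where R: "(Q, R) \<in> path_cover"
        using motzkin_path_valley_rotates eq by blast
      then have "R \<in> motzkin_paths n" using path_cover_motzkin_paths QM by blast
      then show False using R QM Q(2) by blast
    qed
    show "hdist Q = 0" using QM by (simp add: motzkin_paths_def motzkin_path_iff)
  qed
  then show "(P, highest (skeleton P)) \<in> motzkin_order n"
    using Q(1) rtrancl_path_cover_skeleton[OF Q(1)] assms
    by (simp add: motzkin_order_def rotation_order_iff)
  have "finite (?r\<inverse>)" "acyclic (?r\<inverse>)" using fin acyc by simp_all
  then obtain L where L: "(P, L) \<in> (?r\<inverse>)\<^sup>*" "\<And>R. (L, R) \<notin> ?r\<inverse>"
    using finite_acyclic_reaches_maximal[of "?r\<inverse>" P] by metis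
  then have LP: "(L, P) \<in> ?r\<^sup>*" by (simp only: rtrancl_converse converse_iff)
  then have LM: "L \<in> motzkin_paths n" using assms by (cases rule: converse_rtranclE) auto
  have "hdist L \<ge> 0 \<and> (hdist L = 0 \<longrightarrow> L = lowest (skeleton L))"
  proof (rule every_E_after_N_eq_lowest)
    show "s = N" if eq: "L = U @ s # E # V" for U s V
    proof (rule ccontr)
      assume "s \<noteq> N"
      moreover have "motzkin_path (U @ s # E # V)"
        using LM unfolding eq motzkin_paths_def by blast
      ultimately obtain R where R: "(R, L) \<in> path_cover"
        using motzkin_path_rotates_down eq by blast
      then have "R \<in> motzkin_paths n" using path_cover_motzkin_paths LM by blast
      then show False using R LM L(2) by blast
    qed
    show "L \<noteq> E # V" for V
      using LM stays_above_start[of "-1" V] by (auto simp: motzkin_paths_def motzkin_path_iff)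
  qed
  then have "L = lowest (skeleton L)" using LM by (simp add: motzkin_paths_def motzkin_path_iff)
  then show "(lowest (skeleton P), P) \<in> motzkin_order n"
    using LP LM rtrancl_path_cover_skeleton[OF LP]
    by (simp add: motzkin_order_def rotation_order_iff)
qed


section \<open>Connected components\<close>

text \<open>Induction on the size of the interval from \<open>x\<close> to \<open>y\<close>: a point
  strictly between them splits it into two smaller intervals.\<close>

lemma finite_order_subset_rtrancl_hasse:
  assumes "finite A" "partial_order_on A r" "(x, y) \<in> r"
  shows "(x, y) \<in> (hasse_diagram A r)\<^sup>*"
  using assms(3)
proof (induction "card {z. (x, z) \<in> r \<and> (z, y) \<in> r}" arbitrary: x y rule: less_induct)
  case less
  have r: "r \<subseteq> A \<times> A" "refl_on A r" "trans r" "antisym r"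
    using assms(2) by (auto simp: partial_order_on_def preorder_on_def)
  have fin: "finite {z. (x, z) \<in> r \<and> (z, y) \<in> r}" for x y
    using assms(1) by (rule rev_finite_subset) (use r in auto)
  consider "x = y" | "(x, y) \<in> hasse_diagram A r"
    | z where "z \<noteq> x" "z \<noteq> y" "(x, z) \<in> r" "(z, y) \<in> r"
    using less.prems r(1) by (auto simp: hasse_diagram_def)
  then show ?case
  proof cases
    case 3
    have xy: "(x, x) \<in> r" "(y, y) \<in> r" "(y, z) \<notin> r" "(z, x) \<notin> r"
      using 3 r by (auto simp: refl_on_def dest: antisymD)
    have "{u. (x, u) \<in> r \<and> (u, z) \<in> r} \<subset> {u. (x, u) \<in> r \<and> (u, y) \<in> r}"
      using 3(4) less.prems xy \<open>trans r\<close> by (blast dest: transD)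
    moreover have "{u. (z, u) \<in> r \<and> (u, y) \<in> r} \<subset> {u. (x, u) \<in> r \<and> (u, y) \<in> r}"
      using 3(3) less.prems xy \<open>trans r\<close> by (blast dest: transD)
    ultimately have "(x, z) \<in> (hasse_diagram A r)\<^sup>*" "(z, y) \<in> (hasse_diagram A r)\<^sup>*"
      using less.hyps[OF psubset_card_mono[OF fin]] 3(3,4) by simp_all
    then show ?thesis by simp
  qed auto
qed

lemma connected_components_motzkin_order:
  "connected_components (motzkin_paths n) (motzkin_order n) =
     {{P \<in> motzkin_paths n. cls P = c} | c. c \<in> cls ` motzkin_paths n}"
proof -
  let ?M = "motzkin_paths n" and ?r = "motzkin_order n"
  let ?h = "hasse_diagram ?M ?r"
  let ?s = "(?h \<union> ?h\<inverse>)\<^sup>*"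
  have "?s `` {P} = {Q \<in> ?M. cls Q = cls P}" if P: "P \<in> ?M" for P
  proof (intro set_eqI iffI)
    fix Q assume "Q \<in> ?s `` {P}"
    then have "(P, Q) \<in> ?s" by simp
    then show "Q \<in> {Q \<in> ?M. cls Q = cls P}"
    proof (induction rule: rtrancl_induct)
      case (step Q R)
      then have "(Q, R) \<in> ?r \<or> (R, Q) \<in> ?r" "R \<in> ?M" by (auto simp: hasse_diagram_def)
      then have "skeleton Q = skeleton R"
        using rtrancl_path_cover_skeleton[of Q R ?M] rtrancl_path_cover_skeleton[of R Q ?M]
        by (auto simp: motzkin_order_def rotation_order_def)
      then have "cls Q = cls R" using cls_skeleton[of Q] cls_skeleton[of R] by simp
      then show ?case using step.IH \<open>R \<in> ?M\<close> by simp
    qed (use P in simp)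
  next
    fix Q assume "Q \<in> {Q \<in> ?M. cls Q = cls P}"
    then have Q: "Q \<in> ?M" "skeleton Q = skeleton P" using P cls_eq_iff_skeleton by auto
    \<comment> \<open>Paths with equal skeletons lie below the same highest path and are connected
      through it.\<close>
    have hasse: "(R, highest (skeleton R)) \<in> ?h\<^sup>*" if "R \<in> ?M" for R
      using motzkin_between_extremal(1)[OF that] finite_motzkin_paths
        partial_order_rotation_order[of ?M, folded motzkin_order_def]
      by (intro finite_order_subset_rtrancl_hasse)
    have "sym ?s" by (intro sym_rtrancl) (auto simp: sym_def)
    moreover have "?h\<^sup>* \<subseteq> ?s" by (intro rtrancl_mono) auto
    ultimately have "(P, highest (skeleton P)) \<in> ?s" "(highest (skeleton P), Q) \<in> ?s"
      using hasse[OF P] hasse[OF Q(1)] unfolding Q(2) by (blast dest: symD)+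
    then show "Q \<in> ?s `` {P}" by simp
  qed
  then have "(\<lambda>P. ?s `` {P}) ` ?M = (\<lambda>P. {Q \<in> ?M. cls Q = cls P}) ` ?M"
    by (rule image_cong[OF refl])
  moreover have "connected_components ?M ?r = (\<lambda>P. ?s `` {P}) ` ?M"
    by (auto simp: connected_components_def quotient_def)
  moreover have "(\<lambda>P. {Q \<in> ?M. cls Q = cls P}) ` ?M = {{P \<in> ?M. cls P = c} | c. c \<in> cls ` ?M}"
    by auto
  ultimately show ?thesis by simp
qed


section \<open>The inverse of the bijection\<close>

text \<open>A letterwise form of \<open>\<phi>_inv\<close>, justified by
  \<open>\<phi>_inv_eq_expand\<close>. The image of each letter contains exactly one
  \<open>E\<close>, as its last step.\<close>

primrec expand :: "step list \<Rightarrow> step list" where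
  "expand [] = []"
| "expand (s # P) = (case s of N \<Rightarrow> [N, N, E] | D \<Rightarrow> [N, E] | E \<Rightarrow> [E]) @ expand P"

lemma expand_append [simp]: "expand (P @ Q) = expand P @ expand Q"
  by (induction P) auto

lemma expand_replicate_E [simp]: "expand (replicate k E) = replicate k E"
  by (induction k) auto

lemma expand_Nil_iff [simp]: "expand P = [] \<longleftrightarrow> P = []"
  by (cases P) (auto split: step.splits)

lemma hdist_expand [simp]: "hdist (expand P) = hdist P"
  by (induction P) (auto split: step.splits)

lemma stays_above_expand [simp]: "stays_above h (expand P) \<longleftrightarrow> stays_above h P"
proof (induction P arbitrary: h)
  case (Cons s P)
  show ?case by (cases s) (auto simp: Cons.IH ac_simps)
qed simp

lemma D_notin_expand [simp]: "D \<notin> set (expand P)"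
  by (induction P) (auto split: step.splits)

lemma length_expand: "int (length (expand P)) = 2 * int (length P) + hdist P"
  by (induction P) (auto split: step.splits)

lemma expand_in_dyck_paths_iff: "expand P \<in> dyck_paths (2 * n) \<longleftrightarrow> P \<in> motzkin_paths n"
  using length_expand[of P]
  by (auto simp: dyck_paths_def dyck_path_def motzkin_paths_def motzkin_path_iff)

lemma NNN_avoiding_expand: "\<not> sublist [N, N, N] (expand P)"
proof (induction P)
  case (Cons s P)
  have "\<not> prefix [N, N] (E # Q)" for Q by simp
  with Cons show ?case
    by (cases s) (simp_all add: sublist_Cons_right)
qed simp

text \<open>At most two \<open>N\<close> steps precede the first \<open>E\<close>, so the word up to
  this \<open>E\<close> is the image of one letter. The condition on the last step excludes trailing
  \<open>N\<close> steps.\<close>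

lemma NNN_avoiding_eq_expand:
  assumes "\<not> sublist [N, N, N] R" "D \<notin> set R" "R \<noteq> [] \<Longrightarrow> last R = E"
  shows "\<exists>P. R = expand P"
  using assms
proof (induction R rule: length_induct)
  case (1 R)
  have IH: "\<exists>P. Q = expand P" if "R = X @ E # Q" for X Q
  proof -
    have "\<not> sublist [N, N, N] Q" using 1(2) that by (auto simp: sublist_append sublist_Cons_right)
    moreover have "last Q = E" if "Q \<noteq> []" using 1(4) that \<open>R = X @ E # Q\<close> by simp
    ultimately show ?thesis using 1(1,3) that by simp
  qed
  have "R = [] \<or> (\<exists>Q. R = E # Q) \<or> (\<exists>Q. R = [N] @ E # Q) \<or> (\<exists>Q. R = [N, N] @ E # Q)"
  proof (cases R)
    case R: (Cons s R1)
    show ?thesis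
    proof (cases R1)
      case R1: (Cons t R2)
      show ?thesis
      proof (cases R2)
        case (Cons u Q)
        then show ?thesis using 1(2,3) R R1
          by (cases s; cases t; cases u) (auto simp: sublist_Cons_right)
      qed (use 1(3,4) R R1 in \<open>cases s; cases t; auto\<close>)
    qed (use 1(3,4) R in \<open>cases s; auto\<close>)
  qed simp
  then consider "R = []" | Q where "R = E # Q" | Q where "R = [N] @ E # Q"
    | Q where "R = [N, N] @ E # Q"
    by blast
  then show ?case
  proof cases
    case 1
    then show ?thesis by (intro exI[of _ "[]"]) simp
  next
    case (2 Q)
    then obtain P where "Q = expand P" using IH[of "[]" Q] by auto
    then show ?thesis using 2 by (intro exI[of _ "E # P"]) simp
  next
    case (3 Q)
    then obtain P where "Q = expand P" using IH[of "[N]" Q] by auto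
    then show ?thesis using 3 by (intro exI[of _ "D # P"]) simp
  next
    case (4 Q)
    then obtain P where "Q = expand P" using IH[of "[N, N]" Q] by auto
    then show ?thesis using 4 by (intro exI[of _ "N # P"]) simp
  qed
qed

lemma dyck_path_last:
  assumes "dyck_path R"
  shows "last R = E" "R \<noteq> []"
proof -
  have R: "R \<noteq> []" "hdist R = 0" "stays_above 0 R" "D \<notin> set R"
    using assms by (auto simp: dyck_path_def motzkin_path_iff)
  then obtain R' s where R': "R = R' @ [s]" by (cases R rule: rev_cases) auto
  then have "hdist R' \<ge> 0" using R stays_above_end[of 0 R'] by simp
  then show "last R = E" "R \<noteq> []" using R R' by (cases s; simp)+
qed

section \<open>Decomposition into runs and inversion of \<open>\<phi>\<close>\<close>

definition runs_word :: "(nat \<times> nat) list \<Rightarrow> step list" where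
  "runs_word rs = concat (map (\<lambda>(a, b). replicate a N @ replicate b E) rs)"

lemma runs_word_simps [simp]:
  "runs_word [] = []"
  "runs_word ((a, b) # rs) = replicate a N @ replicate b E @ runs_word rs"
  by (simp_all add: runs_word_def)

lemma replicate_append_eqD:
  assumes "replicate a x @ u = replicate b x @ v" "u \<noteq> [] \<Longrightarrow> hd u \<noteq> x" "v \<noteq> [] \<Longrightarrow> hd v \<noteq> x"
  shows "a = b \<and> u = v"
  using assms
proof (induction a arbitrary: b)
  case 0
  then show ?case by (cases b) auto
next
  case (Suc a)
  then show ?case by (cases b) auto
qed

text \<open>Positive exponents make every block of equal letters maximal, so the exponents can be
  read off from the left.\<close>

lemma runs_word_inj:
  assumes "runs_word rs = runs_word ss"
    and "\<forall>(a, b)\<in>set rs. a \<ge> 1 \<and> b \<ge> 1" "\<forall>(a, b)\<in>set ss. a \<ge> 1 \<and> b \<ge> 1"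
  shows "rs = ss"
  using assms
proof (induction rs arbitrary: ss)
  case Nil
  then show ?case by (cases ss) auto
next
  case (Cons r rs)
  have hd_word: "hd (runs_word ts) \<noteq> E"
    if "\<forall>(a, b)\<in>set ts. a \<ge> 1 \<and> b \<ge> 1" "runs_word ts \<noteq> []" for ts
    using that by (cases ts) (auto simp: hd_append)
  obtain a b where r: "r = (a, b)" by fastforce
  with Cons.prems obtain c d ss' where ss: "ss = (c, d) # ss'" by (cases ss) auto
  have pos: "a \<ge> 1" "b \<ge> 1" "c \<ge> 1" "d \<ge> 1" using Cons.prems r ss by auto
  have "a = c \<and> replicate b E @ runs_word rs = replicate d E @ runs_word ss'"
    using Cons.prems(1) r ss pos by (intro replicate_append_eqD[where x = N]) (auto simp: hd_append)
  moreover from this have "b = d \<and> runs_word rs = runs_word ss'"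
    using Cons.prems r ss hd_word[of rs] hd_word[of ss']
    by (intro replicate_append_eqD[where x = E]) auto
  ultimately show ?case using Cons.IH[of ss'] Cons.prems r ss by auto
qed

text \<open>One list of runs describes both words: a letter other than \<open>E\<close> followed by
  \<open>k\<close> letters \<open>E\<close> expands to a run pair with \<open>b = Suc k\<close>, the
  additional \<open>E\<close> being the last step of the image of that letter.\<close>

lemma ex_runs:
  assumes "P = [] \<or> hd P \<noteq> E"
  shows "\<exists>rs. (\<forall>(a, b)\<in>set rs. a \<in> {1, 2} \<and> b \<ge> 1) \<and>
    P = concat (map (\<lambda>(a, b). \<xi> a # replicate (b - 1) E) rs) \<and> expand P = runs_word rs"
  using assms
proof (induction P rule: length_induct)
  case (1 P)
  show ?case
  proof (cases P)
    case Nil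
    then show ?thesis by (intro exI[of _ "[]"]) simp
  next
    case (Cons s P')
    define k where "k = length (takeWhile (\<lambda>t. t = E) P')"
    define Q where "Q = dropWhile (\<lambda>t. t = E) P'"
    define a where "a = (if s = D then 1 else 2 :: nat)"
    have "takeWhile (\<lambda>t. t = E) P' = replicate k E"
      unfolding k_def by (rule replicate_length_same[symmetric]) (auto dest: set_takeWhileD)
    then have P': "P' = replicate k E @ Q"
      unfolding Q_def by (metis takeWhile_dropWhile_id)
    moreover have "Q = [] \<or> hd Q \<noteq> E" unfolding Q_def using hd_dropWhile by blast
    moreover have "length Q < length P" using P' Cons by simp
    ultimately obtain rs where rs: "\<forall>(a, b)\<in>set rs. a \<in> {1, 2} \<and> b \<ge> 1"
      "Q = concat (map (\<lambda>(a, b). \<xi> a # replicate (b - 1) E) rs)" "expand Q = runs_word rs"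
      using 1(1) by blast
    have "s = \<xi> a" "s = N \<or> s = D"
      using 1(2) Cons by (cases s; simp add: a_def \<xi>_def)+
    then show ?thesis using rs Cons P'
      by (intro exI[of _ "(a, Suc k) # rs"])
        (auto simp: a_def \<xi>_def replicate_append_same numeral_2_eq_2)
  qed
qed

lemma motzkin_path_hd: "motzkin_path P \<Longrightarrow> hd P \<noteq> E"
  using stays_above_start[of "-1" "tl P"]
  by (cases P; cases "hd P") (auto simp: motzkin_path_iff)

lemma \<phi>_expand:
  assumes "motzkin_path P"
  shows "\<phi> (expand P) = P"
proof -
  obtain rs where rs: "\<forall>(a, b)\<in>set rs. a \<in> {1, 2} \<and> b \<ge> 1"
    "P = concat (map (\<lambda>(a, b). \<xi> a # replicate (b - 1) E) rs)" "expand P = runs_word rs"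
    using ex_runs motzkin_path_hd[OF assms] by metis
  \<comment> \<open>The definite description has a value because the decomposition is
    unique.\<close>
  have "run_lengths (expand P) = rs"
    unfolding run_lengths_def
  proof (rule the_equality)
    fix ss
    assume "(\<forall>(a, b)\<in>set ss. a \<in> {1, 2} \<and> b \<ge> 1) \<and>
      expand P = concat (map (\<lambda>(a, b). replicate a N @ replicate b E) ss)"
    then show "ss = rs" using rs(1,3) by (intro runs_word_inj) (fastforce simp: runs_word_def)+
  qed (use rs in \<open>auto simp: runs_word_def\<close>)
  then show ?thesis using rs(2) by (simp add: \<phi>_def)
qed

lemma NNN_avoiding_dyck_paths_eq: "NNN_avoiding_dyck_paths = expand ` {P. motzkin_path P}"
proof -
  have motz: "dyck_path (expand P) \<longleftrightarrow> motzkin_path P" for P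
    by (simp add: dyck_path_def motzkin_path_iff)
  moreover have "\<exists>P. R = expand P" if "dyck_path R" "\<not> sublist [N, N, N] R" for R
    using that NNN_avoiding_eq_expand[of R] dyck_path_last[of R] by (auto simp: dyck_path_def)
  ultimately show ?thesis
    unfolding NNN_avoiding_dyck_paths_def using NNN_avoiding_expand by blast
qed

lemma \<phi>_inv_eq_expand:
  assumes "motzkin_path P"
  shows "\<phi>_inv P = expand P"
proof -
  have "inj_on \<phi> NNN_avoiding_dyck_paths"
    by (rule inj_on_inverseI[of _ expand]) (auto simp: NNN_avoiding_dyck_paths_eq \<phi>_expand)
  moreover have "expand P \<in> NNN_avoiding_dyck_paths"
    using assms by (simp add: NNN_avoiding_dyck_paths_eq)
  ultimately show ?thesis
    unfolding \<phi>_inv_def using \<phi>_expand[OF assms] by (rule inv_into_f_eq)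
qed


section \<open>Types\<close>

text \<open>Unlike \<open>path_type\<close>, \<open>full_type\<close> keeps the letter of the last north step.\<close>

primrec full_type :: "step list \<Rightarrow> step list" where
  "full_type [] = []"
| "full_type (s # R) =
     (if s = N then [if R \<noteq> [] \<and> hd R = E then N else E] else []) @ full_type R"

lemma path_type_eq_full_type: "path_type R = butlast (full_type R)"
proof -
  have "map (\<lambda>i. if Suc i < length R \<and> R ! Suc i = E then N else E)
    (filter (\<lambda>i. R ! i = N) [0..<length R]) = full_type R"
  proof (induction R)
    case (Cons s R)
    have *: "[0..<length (s # R)] = 0 # map Suc [0..<length R]"
      by (simp add: upt_conv_Cons map_Suc_upt del: upt_Suc)
    show ?case
      unfolding * using Cons by (auto simp: filter_map o_def hd_conv_nth)
  qed simp
  then show ?thesis by (simp add: path_type_def map_butlast)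
qed

text \<open>The letter of an \<open>N\<close> step depends only on the next step, so a cut is
  harmless unless it separates an \<open>N\<close> from an \<open>E\<close> after it.\<close>

lemma full_type_append_E: "full_type (X @ E # Y) = full_type (X @ [E]) @ full_type Y"
  by (induction X) (auto simp: hd_append)

text \<open>A final \<open>N\<close> of \<open>X\<close> has the letter \<open>E\<close> both at the
  end of a word and in front of another \<open>N\<close>.\<close>

lemma full_type_append_N: "full_type (X @ N # Y) = full_type X @ full_type (N # Y)"
  by (induction X) (auto simp: hd_append)

lemma full_type_snoc_E:
  "full_type (X @ [E]) = (if X \<noteq> [] \<and> last X = N then butlast (full_type X) @ [N] else full_type X)"
proof (cases X rule: rev_cases)
  case (snoc X' s)
  have "full_type (X' @ [E, E]) = full_type (X' @ [E])"
    using full_type_append_E[of X' "[E]"] by simp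
  moreover have "full_type (X' @ [N, E]) = full_type X' @ [N]"
    using full_type_append_N[of X' "[E]"] by simp
  moreover have "full_type (X' @ [N]) = full_type X' @ [E]"
    using full_type_append_N[of X' "[]"] by simp
  moreover have "full_type (X' @ [D, E]) = full_type (X' @ [D])"
    by (induction X') (auto simp: hd_append)
  ultimately show ?thesis using snoc by (cases s) simp_all
qed simp

lemma set_full_type: "set (full_type R) \<subseteq> {N, E}"
  by (induction R) auto

lemma full_type_Nil: "N \<notin> set R \<Longrightarrow> full_type R = []"
  by (induction R) auto

lemma last_full_type:
  assumes "N \<in> set R" "last R = E" "D \<notin> set R"
  shows "full_type R \<noteq> [] \<and> last (full_type R) = N"
  using assms
proof (induction R)
  case (Cons s R)
  show ?case
  proof (cases "N \<in> set R")
    case True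
    then show ?thesis using Cons by (cases R) auto
  next
    case False
    then have s: "s = N" using Cons.prems by auto
    then obtain t R' where R: "R = t # R'" using Cons.prems by (cases R) auto
    then have "t = E" using False Cons.prems by (cases t) auto
    moreover have "full_type R' = []" using False R by (simp add: full_type_Nil)
    ultimately show ?thesis using s R by simp
  qed
qed simp

text \<open>Only \<open>E\<close> steps follow the last \<open>N\<close>, so the letter that
  \<open>path_type\<close> discards is always \<open>N\<close> and no information is lost.\<close>

lemma dyck_path_full_type:
  assumes "dyck_path R"
  shows "full_type R = path_type R @ [N]"
proof -
  have R: "R \<noteq> []" "last R = E" "D \<notin> set R" "hdist R = 0"
    using assms dyck_path_last by (auto simp: dyck_path_def motzkin_path_iff)
  have "hd R \<noteq> E" using assms motzkin_path_hd by (simp add: dyck_path_def)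
  then have "hd R = N" using R hd_in_set[of R] by (cases "hd R") auto
  then have "N \<in> set R" using R by (metis hd_in_set)
  then show ?thesis
    using last_full_type[of R] R append_butlast_last_id unfolding path_type_eq_full_type by metis
qed

text \<open>The letters that the images \<open>NNE\<close> and \<open>NE\<close> contribute to the
  full type.\<close>

primrec skeleton_type :: "step list \<Rightarrow> step list" where
  "skeleton_type [] = []"
| "skeleton_type (s # P) = (case s of N \<Rightarrow> [E, N] | D \<Rightarrow> [N] | E \<Rightarrow> []) @ skeleton_type P"

lemma full_type_expand: "full_type (expand P) = skeleton_type (skeleton P)"
proof (induction P)
  case (Cons s P)
  then show ?case by (cases s) auto
qed simp

text \<open>The blocks \<open>[E, N]\<close> and \<open>[N]\<close> begin with different letters, so
  the word can be decoded from the left.\<close>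

lemma skeleton_type_inj:
  assumes "skeleton_type v = skeleton_type w" "E \<notin> set v" "E \<notin> set w"
  shows "v = w"
  using assms
proof (induction v arbitrary: w)
  case Nil
  then show ?case by (cases w) (auto split: step.splits)
next
  case (Cons s v)
  then obtain t w' where "w = t # w'" by (cases w) (auto split: step.splits)
  then show ?case using Cons.IH[of w'] Cons.prems by (cases s; cases t) auto
qed

lemma EE_avoiding_skeleton_type: "\<not> sublist [E, E] (skeleton_type w)"
  by (induction w) (auto simp: sublist_Cons_right split: step.splits)

text \<open>Each letter \<open>E\<close> is followed by an \<open>N\<close>, so the word splits into
  blocks \<open>[E, N]\<close> and \<open>[N]\<close>.\<close>

lemma EE_avoiding_eq_skeleton_type:
  assumes "set v \<subseteq> {N, E}" "\<not> sublist [E, E] v" "v \<noteq> [] \<Longrightarrow> last v = N"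
  shows "\<exists>w. v = skeleton_type w \<and> E \<notin> set w"
  using assms
proof (induction v rule: length_induct)
  case (1 v)
  have IH: "\<exists>w. u = skeleton_type w \<and> E \<notin> set w" if "v = x @ N # u" for x u
  proof -
    have "\<not> sublist [E, E] u" using 1(3) that by (auto simp: sublist_append sublist_Cons_right)
    moreover have "last u = N" if "u \<noteq> []" using 1(4) that \<open>v = x @ N # u\<close> by simp
    ultimately show ?thesis using 1(1,2) that by simp
  qed
  show ?case
  proof (cases v)
    case Nil
    then show ?thesis by (intro exI[of _ "[]"]) simp
  next
    case (Cons s v')
    show ?thesis
    proof (cases s)
      case N
      then obtain w where "v' = skeleton_type w" "E \<notin> set w" using IH[of "[]" v'] Cons by auto
      then show ?thesis using Cons N by (intro exI[of _ "D # w"]) simp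
    next
      case E
      then obtain t u where v': "v' = t # u" using 1(4) Cons by (cases v') auto
      then have "t = N" using 1(2,3) Cons E by (auto simp: sublist_Cons_right)
      then obtain w where "u = skeleton_type w" "E \<notin> set w"
        using IH[of "[E]" u] Cons E v' by auto
      then show ?thesis using Cons E v' \<open>t = N\<close> by (intro exI[of _ "N # w"]) simp
    qed (use 1(2) Cons in simp)
  qed
qed

lemma length_full_type_expand: "int (length (full_type (expand P))) = int (length P) + hdist P"
proof (induction P)
  case (Cons s P)
  then show ?case by (cases s) auto
qed simp

lemma path_type_expand:
  assumes "P \<in> motzkin_paths n"
  shows "path_type (expand P) @ [N] = skeleton_type (skeleton P)"
    and "path_type (expand P) \<in> EE_avoiding_words (n - 1)"
proof -
  have P: "dyck_path (expand P)" "length P = n" "hdist P = 0"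
    using assms expand_in_dyck_paths_iff[of P n]
    by (auto simp: dyck_paths_def motzkin_paths_def motzkin_path_iff)
  then have type: "full_type (expand P) = path_type (expand P) @ [N]"
    using dyck_path_full_type by blast
  then show *: "path_type (expand P) @ [N] = skeleton_type (skeleton P)"
    by (simp add: full_type_expand)
  have "\<not> sublist [E, E] (path_type (expand P))"
    using EE_avoiding_skeleton_type[of "skeleton P"] unfolding *[symmetric] sublist_append by blast
  moreover have "length (path_type (expand P)) = n - 1"
    using length_full_type_expand[of P] P type by simp
  moreover have "set (path_type (expand P)) \<subseteq> {N, E}"
    using set_full_type[of "expand P"] type by auto
  ultimately show "path_type (expand P) \<in> EE_avoiding_words (n - 1)"
    by (simp add: EE_avoiding_words_def)
qed

lemma path_type_expand_eq_iff:
  assumes "P \<in> motzkin_paths n" "Q \<in> motzkin_paths n"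
  shows "path_type (expand P) = path_type (expand Q) \<longleftrightarrow> skeleton P = skeleton Q"
proof
  assume "path_type (expand P) = path_type (expand Q)"
  then have "skeleton_type (skeleton P) = skeleton_type (skeleton Q)"
    using path_type_expand(1) assms by metis
  then show "skeleton P = skeleton Q" by (rule skeleton_type_inj) simp_all
next
  assume "skeleton P = skeleton Q"
  then show "path_type (expand P) = path_type (expand Q)"
    using path_type_expand(1) assms by (metis append1_eq_conv)
qed

text \<open>The first two of three consecutive \<open>N\<close> steps get the letter
  \<open>E\<close>. The third also contributes a letter, so dropping the last letter of the type
  keeps these two.\<close>

lemma NNN_imp_EE_path_type: "sublist [N, N, N] R \<Longrightarrow> sublist [E, E] (path_type R)"
proof -
  have "sublist [E, E] (butlast (full_type R)) \<and> full_type R \<noteq> []" if "sublist [N, N, N] R"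
    using that
  proof (induction R)
    case (Cons s R)
    show ?case
    proof (cases "sublist [N, N, N] R")
      case True
      then show ?thesis using Cons.IH by (auto simp: sublist_Cons_right)
    next
      case False
      then obtain Q where "s = N" "R = N # N # Q"
        using Cons.prems by (auto simp: sublist_Cons_right prefix_def)
      then show ?thesis by (auto simp: sublist_Cons_right)
    qed
  qed simp
  then show "sublist [N, N, N] R \<Longrightarrow> sublist [E, E] (path_type R)"
    by (simp add: path_type_eq_full_type)
qed

lemma dyck_paths_of_type_expand:
  assumes "\<nu> \<in> EE_avoiding_words k" "R \<in> dyck_paths_of_type (2 * n) \<nu>"
  shows "\<exists>P\<in>motzkin_paths n. R = expand P"
proof -
  have R: "R \<in> dyck_paths (2 * n)" "dyck_path R" "path_type R = \<nu>"
    using assms(2) by (auto simp: dyck_paths_of_type_def dyck_paths_def)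
  then have "\<not> sublist [N, N, N] R"
    using NNN_imp_EE_path_type[of R] assms(1) by (auto simp: EE_avoiding_words_def)
  then obtain P where "R = expand P"
    using R(2) NNN_avoiding_eq_expand[of R] dyck_path_last[of R] by (auto simp: dyck_path_def)
  then show ?thesis using R(1) expand_in_dyck_paths_iff by blast
qed


section \<open>Rotations and types\<close>

text \<open>Since \<open>B\<close> begins with \<open>N\<close> and ends with \<open>E\<close>, both
  words can be cut around it. The two types can then differ only in whether \<open>U\<close> is
  followed by the moved \<open>E\<close>.\<close>

lemma path_cover_full_type:
  assumes "D \<notin> set B" "excursion B"
  shows "full_type (U @ [E] @ B @ V) = full_type (U @ [E]) @ full_type B @ full_type V"
    and "full_type (U @ B @ [E] @ V) = full_type U @ full_type B @ full_type V"
proof -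
  obtain C where B: "B = N # C @ [E]" using assms by (auto simp: excursion_def)
  have B_append: "full_type (B @ W) = full_type B @ full_type W" for W
    using full_type_append_E[of "N # C" W] unfolding B append.assoc append_Cons append_Nil .
  have "full_type (U @ [E] @ B @ V) = full_type (U @ [E]) @ full_type (B @ V)"
    using full_type_append_E[of U "B @ V"] by (simp only: append_Cons append_Nil)
  then show "full_type (U @ [E] @ B @ V) = full_type (U @ [E]) @ full_type B @ full_type V"
    by (simp only: B_append)
  have "full_type (U @ B @ [E] @ V) = full_type U @ full_type (B @ [E] @ V)"
    using full_type_append_N[of U "C @ [E] @ [E] @ V"] unfolding B append.assoc append_Cons append_Nil .
  then show "full_type (U @ B @ [E] @ V) = full_type U @ full_type B @ full_type V"
    by (simp only: B_append append_Cons append_Nil full_type.simps(2)) simp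
qed

text \<open>Only an \<open>N\<close> step directly before the moved \<open>E\<close> is affected:
  afterwards the first \<open>N\<close> of \<open>B\<close> follows it, so its letter turns from
  \<open>N\<close> to \<open>E\<close>.\<close>

lemma path_cover_count_full_type:
  assumes "(R, S) \<in> path_cover" "D \<notin> set R"
  shows "full_type S = full_type R \<or>
    count_list (full_type S) E = Suc (count_list (full_type R) E)"
proof -
  obtain U B V where UBV: "R = U @ [E] @ B @ V" "S = U @ B @ [E] @ V" "excursion B"
    using assms(1) path_cover_iff by blast
  then have "D \<notin> set B" using assms(2) by simp
  note type = path_cover_full_type[OF this UBV(3), of U V, folded UBV(1,2)]
  show ?thesis
  proof (cases "U \<noteq> [] \<and> last U = N")
    case True
    then obtain U' where "U = U' @ [N]" by (metis append_butlast_last_id)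
    then have "full_type U = full_type U' @ [E]" "full_type (U @ [E]) = full_type U' @ [N]"
      using full_type_append_N[of U' "[]"] full_type_append_N[of U' "[E]"] by simp_all
    then show ?thesis using type by simp
  next
    case False
    then have "full_type (U @ [E]) = full_type U" by (simp only: full_type_snoc_E if_False)
    then show ?thesis using type by simp
  qed
qed

text \<open>The image of a letter has its only \<open>E\<close> at the end, so a cut after an
  \<open>E\<close> falls between the images of two letters.\<close>

lemma expand_split_E:
  assumes "expand P = X @ E # Y"
  shows "\<exists>P1 P2. P = P1 @ P2 \<and> expand P1 = X @ [E] \<and> expand P2 = Y"
  using assms
proof (induction P arbitrary: X)
  case (Cons s P)
  define b where "b = butlast (expand [s])"
  have b: "expand [s] = b @ [E]" "E \<notin> set b" by (cases s; simp add: b_def)+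
  then have eq: "b @ E # expand P = X @ E # Y" using Cons.prems by simp
  show ?case
  proof (cases "X = b")
    case True
    then show ?thesis using eq b
      by (intro exI[of _ "[s]"] exI[of _ P]) simp
  next
    case False
    have "\<exists>X'. X = b @ E # X'"
    proof -
      from eq consider Z where "b = X @ Z" "Z @ E # expand P = E # Y"
        | Z where "X = b @ Z" "E # expand P = Z @ E # Y"
        by (auto simp: append_eq_append_conv2)
      then show ?thesis
      proof cases
        case 1
        then show ?thesis using False b(2) by (cases Z) auto
      next
        case 2
        then show ?thesis using False by (cases Z) auto
      qed
    qed
    then obtain X' where X': "X = b @ E # X'" ..
    then have "expand P = X' @ E # Y" using eq by simp
    then obtain P1 P2 where "P = P1 @ P2" "expand P1 = X' @ [E]" "expand P2 = Y"
      using Cons.IH by blast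
    moreover from this have "expand (s # P1) = X @ [E]"
      using X' b(1) expand_append[of "[s]" P1] by simp
    ultimately show ?thesis by (intro exI[of _ "s # P1"] exI[of _ P2]) simp
  qed
qed simp

lemma excursion_expand_iff: "excursion (expand B) \<longleftrightarrow> excursion B"
proof
  assume "excursion B"
  then show "excursion (expand B)"
  proof (unfold excursion_def, elim disjE exE conjE)
    assume "B = [D]"
    then show "expand B = [D] \<or> (\<exists>C. expand B = N # C @ [E] \<and> hdist C = 0 \<and> stays_above 0 C)"
      by (intro disjI2 exI[of _ "[]"]) simp
  next
    fix C assume "B = N # C @ [E]" "hdist C = 0" "stays_above 0 C"
    then show "expand B = [D] \<or> (\<exists>C. expand B = N # C @ [E] \<and> hdist C = 0 \<and> stays_above 0 C)"
      by (intro disjI2 exI[of _ "N # E # expand C"]) simp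
  qed
next
  assume exc: "excursion (expand B)"
  have "expand B \<noteq> [D]" using D_notin_expand[of B] by (metis list.set_intros(1))
  then obtain C where C: "expand B = N # C @ [E]" "hdist C = 0" "stays_above 0 C"
    using exc by (auto simp: excursion_def)
  then obtain s B' where B: "B = s # B'" by (cases B) auto
  \<comment> \<open>After an initial \<open>D\<close>, any further letter would make
    \<open>C\<close> begin with \<open>E\<close> and fall below its start.\<close>
  have "B' = []" if "s = D"
  proof (rule ccontr)
    assume "B' \<noteq> []"
    then have "C @ [E] = E # expand B'" "expand B' \<noteq> []" using C B that by auto
    then obtain C' where "C = E # C'" by (cases C) auto
    then show False using C(3) stays_above_start[of "-1" C'] by simp
  qed
  moreover have "s \<noteq> E" using C(1) B by auto
  moreover have "\<exists>C. B = N # C @ [E] \<and> hdist C = 0 \<and> stays_above 0 C" if "s = N"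
  proof -
    have C': "C @ [E] = N # E # expand B'" using C(1) B that by simp
    have "hdist B = 0" using excursion_hdist[OF exc] by simp
    then have "B' \<noteq> []" using B that by auto
    then obtain B'' t where B': "B' = B'' @ [t]" by (cases B' rule: rev_cases) auto
    define b where "b = butlast (expand [t])"
    have b: "expand [t] = b @ [E]" by (cases t) (simp_all add: b_def)
    then have "C = N # E # expand B'' @ b" using C' B' by simp
    then have "stays_above 0 B''" using C(3) by simp
    \<comment> \<open>The initial \<open>N\<close> and \<open>B''\<close> together reach height at
      least 1, so the last letter has to descend.\<close>
    moreover from this have "hdist B'' \<ge> 0" using stays_above_end[of 0 B''] by simp
    then have "t = E" using \<open>hdist B = 0\<close> B B' that by (cases t) auto
    ultimately show ?thesis using \<open>hdist B = 0\<close> B B' that by simp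
  qed
  ultimately show "excursion B" using B by (cases s) (auto simp: excursion_def)
qed

lemma path_cover_expand:
  assumes "(P, Q) \<in> path_cover"
  shows "(expand P, expand Q) \<in> path_cover"
proof -
  obtain U B V where "P = U @ [E] @ B @ V" "Q = U @ B @ [E] @ V" "excursion B"
    using assms path_cover_iff by blast
  then have "expand P = expand U @ [E] @ expand B @ expand V"
    "expand Q = expand U @ expand B @ [E] @ expand V" "excursion (expand B)"
    by (simp_all add: excursion_expand_iff)
  then show ?thesis unfolding path_cover_iff by blast
qed

text \<open>In \<open>expand P\<close> every \<open>E\<close> step ends the image of one step of \<open>P\<close>.  A rotation that keeps the
  type has no \<open>N\<close> step before the \<open>E\<close> step it moves, so it cuts \<open>expand P\<close> only after \<open>E\<close> steps
  and comes from a rotation of \<open>P\<close>.\<close>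

lemma path_cover_expandD:
  assumes "(expand P, S) \<in> path_cover" "full_type S = full_type (expand P)" "motzkin_path P"
  shows "\<exists>Q. S = expand Q \<and> (P, Q) \<in> path_cover"
proof -
  obtain U B V where UBV: "expand P = U @ [E] @ B @ V" "S = U @ B @ [E] @ V" "excursion B"
    using assms(1) path_cover_iff by blast
  have DB: "D \<notin> set B" using D_notin_expand[of P] UBV(1) by simp
  then obtain C where B: "B = N # C @ [E]" using UBV(3) by (auto simp: excursion_def)
  have above: "stays_above 0 (U @ [E] @ B @ V)"
    using assms(3) stays_above_expand[of 0 P] UBV(1) by (simp add: motzkin_path_iff)
  have "U \<noteq> []"
  proof
    assume "U = []"
    then show False using above stays_above_start[of "-1"] by fastforce
  qed
  moreover have "full_type (U @ [E]) = full_type U"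
    using path_cover_full_type[OF DB UBV(3), of U V] assms(2) UBV(1,2) by simp
  then have "last U \<noteq> N"
  proof (rule contrapos_pn)
    assume "last U = N"
    then obtain U' where "U = U' @ [N]" using \<open>U \<noteq> []\<close> by (metis append_butlast_last_id)
    then show "full_type (U @ [E]) \<noteq> full_type U"
      using full_type_append_N[of U' "[]"] full_type_append_N[of U' "[E]"] by simp
  qed
  moreover have "last U \<noteq> D"
  proof
    assume "last U = D"
    then have "D \<in> set U" using last_in_set[OF \<open>U \<noteq> []\<close>] by simp
    then show False using D_notin_expand[of P] unfolding UBV(1) by simp
  qed
  ultimately obtain U' where U': "U = U' @ [E]"
    by (metis append_butlast_last_id step.exhaust)
  then have "expand P = U' @ E # E # N # C @ E # V" using UBV(1) B by simp
  then obtain P1 P2 where P1: "P = P1 @ P2" "expand P1 = U" "expand P2 = E # N # C @ E # V"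
    using expand_split_E U' by blast
  then obtain P3 P4 where P2: "P2 = P3 @ P4" "expand P3 = [E]" "expand P4 = (N # C) @ E # V"
    using expand_split_E[of P2 "[]"] by auto
  then have P3: "P3 = [E]" by (cases P3; cases "hd P3") (auto split: step.splits)
  obtain B' V' where "P4 = B' @ V'" "expand B' = B" "expand V' = V"
    using expand_split_E[OF P2(3)] B by auto
  moreover from this have "excursion B'" using UBV(3) excursion_expand_iff by blast
  ultimately have "P = P1 @ [E] @ B' @ V'" "S = expand (P1 @ B' @ [E] @ V')" "excursion B'"
    using P1 P2 P3 UBV(2) by simp_all
  then show ?thesis unfolding path_cover_iff by blast
qed

lemma motzkin_order_imp_tamari_order:
  assumes "(P, Q) \<in> motzkin_order n"
  shows "(expand P, expand Q) \<in> tamari_order (2 * n)"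
proof -
  have PQ: "P \<in> motzkin_paths n" "(P, Q) \<in> (Restr path_cover (motzkin_paths n))\<^sup>*"
    using assms by (auto simp: motzkin_order_def rotation_order_def)
  from PQ(2) have "(expand P, expand Q) \<in> (Restr path_cover (dyck_paths (2 * n)))\<^sup>*"
  proof (induction rule: rtrancl_induct)
    case (step Q R)
    then have "(expand Q, expand R) \<in> Restr path_cover (dyck_paths (2 * n))"
      using path_cover_expand expand_in_dyck_paths_iff by auto
    then show ?case by (rule rtrancl_into_rtrancl[OF step.IH])
  qed simp
  then show ?thesis
    using PQ(1) expand_in_dyck_paths_iff by (simp add: tamari_order_def rotation_order_iff)
qed

text \<open>Each rotation that changes the type increases the number of letters \<open>E\<close>, so
  a chain that leaves a type never returns to it.\<close>

lemma tamari_order_full_type_le: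
  assumes "(R, S) \<in> tamari_order m"
  shows "count_list (full_type R) E < count_list (full_type S) E \<or> full_type R = full_type S"
proof -
  have "(R, S) \<in> (Restr path_cover (dyck_paths m))\<^sup>*"
    using assms by (auto simp: tamari_order_def rotation_order_def)
  then show ?thesis
  proof (induction rule: rtrancl_induct)
    case (step S T)
    then have "D \<notin> set S" "(S, T) \<in> path_cover" by (auto simp: dyck_paths_def dyck_path_def)
    then show ?case using path_cover_count_full_type[of S T] step.IH by auto
  qed simp
qed

lemma tamari_order_expandD:
  assumes "(expand P, S) \<in> tamari_order (2 * n)" "full_type S = full_type (expand P)"
    "P \<in> motzkin_paths n"
  shows "\<exists>Q. S = expand Q \<and> (P, Q) \<in> motzkin_order n"
proof -
  let ?D = "dyck_paths (2 * n)"
  have "(expand P, S) \<in> (Restr path_cover ?D)\<^sup>*"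
    using assms by (auto simp: tamari_order_def rotation_order_def)
  \<comment> \<open>The equality of types is kept as a premise inside the induction: it is known
    only at the end of the chain and is passed back to the earlier paths.\<close>
  then have "full_type S = full_type (expand P) \<longrightarrow> (\<exists>Q. S = expand Q \<and> (P, Q) \<in> motzkin_order n)"
  proof (induction rule: rtrancl_induct)
    case base
    then show ?case using assms(3) by (auto simp: motzkin_order_def rotation_order_iff)
  next
    case (step S T)
    show ?case
    proof
      assume T: "full_type T = full_type (expand P)"
      have ST: "(S, T) \<in> path_cover" "S \<in> ?D" "T \<in> ?D" using step.hyps by auto
      then have "expand P \<in> ?D" "D \<notin> set S"
        using assms(3) expand_in_dyck_paths_iff by (auto simp: dyck_paths_def dyck_path_def)
      have "(expand P, S) \<in> tamari_order (2 * n)"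
        using step.hyps(1) \<open>expand P \<in> ?D\<close> by (simp add: tamari_order_def rotation_order_iff)
      then have S: "full_type S = full_type (expand P)" "full_type T = full_type S"
        using tamari_order_full_type_le path_cover_count_full_type[OF ST(1) \<open>D \<notin> set S\<close>] T
        by fastforce+
      then obtain Q where Q: "S = expand Q" "(P, Q) \<in> motzkin_order n" using step.IH by blast
      then have QM: "Q \<in> motzkin_paths n" by (auto simp: motzkin_order_def rotation_order_def)
      then obtain Q' where Q': "T = expand Q'" "(Q, Q') \<in> path_cover"
        using path_cover_expandD[of Q T] ST(1) S(2) Q(1) by (auto simp: motzkin_paths_def)
      then have "Q' \<in> motzkin_paths n" using path_cover_motzkin_paths QM by blast
      then have "(Q, Q') \<in> Restr path_cover (motzkin_paths n)" using Q'(2) QM by blast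
      moreover have "(P, Q) \<in> (Restr path_cover (motzkin_paths n))\<^sup>*"
        using Q(2) by (simp add: motzkin_order_def rotation_order_def)
      ultimately have "(P, Q') \<in> (Restr path_cover (motzkin_paths n))\<^sup>*"
        by (rule rtrancl_into_rtrancl[rotated])
      then have "(P, Q') \<in> motzkin_order n"
        using rotation_order_iff[OF assms(3)] by (simp add: motzkin_order_def)
      then show "\<exists>Q. T = expand Q \<and> (P, Q) \<in> motzkin_order n" using Q'(1) by blast
    qed
  qed
  then show ?thesis using assms(2) by blast
qed

lemma expand_inj:
  assumes "P \<in> motzkin_paths n" "Q \<in> motzkin_paths n" "expand P = expand Q"
  shows "P = Q"
  using assms \<phi>_expand by (metis mem_Collect_eq motzkin_paths_def)

text \<open>For the converse, equal types give equal full types, so the Tamari chain lifts to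
  Motzkin rotations, and injectivity of \<open>expand\<close> identifies its end with
  \<open>Q\<close>.\<close>

lemma motzkin_order_iff_tamari_order:
  assumes "P \<in> motzkin_paths n" "Q \<in> motzkin_paths n"
  shows "(P, Q) \<in> motzkin_order n \<longleftrightarrow>
    path_type (expand P) = path_type (expand Q) \<and> (expand P, expand Q) \<in> tamari_order (2 * n)"
proof
  assume *: "(P, Q) \<in> motzkin_order n"
  then have "skeleton P = skeleton Q"
    using rtrancl_path_cover_skeleton by (auto simp: motzkin_order_def rotation_order_def)
  then show "path_type (expand P) = path_type (expand Q) \<and>
      (expand P, expand Q) \<in> tamari_order (2 * n)"
    using * motzkin_order_imp_tamari_order path_type_expand_eq_iff[OF assms] by blast
next
  assume *: "path_type (expand P) = path_type (expand Q) \<and>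
    (expand P, expand Q) \<in> tamari_order (2 * n)"
  then have "skeleton P = skeleton Q" using path_type_expand_eq_iff[OF assms] by blast
  then have "full_type (expand Q) = full_type (expand P)" by (simp add: full_type_expand)
  then obtain Q' where "expand Q = expand Q'" "(P, Q') \<in> motzkin_order n"
    using tamari_order_expandD * assms(1) by blast
  moreover from this have "Q' \<in> motzkin_paths n"
    by (auto simp: motzkin_order_def rotation_order_def)
  ultimately show "(P, Q) \<in> motzkin_order n" using expand_inj assms(2) by metis
qed

text \<open>The end points are the images of the lowest and the highest Motzkin path with the
  skeleton \<open>w\<close> that \<open>\<nu>\<close> encodes.\<close>

lemma dyck_paths_of_type_interval:
  assumes "\<nu> \<in> EE_avoiding_words (n - 1)" "n \<ge> 1"
  shows "poset_interval (dyck_paths (2 * n)) (tamari_order (2 * n))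
    (dyck_paths_of_type (2 * n) \<nu>)"
proof -
  let ?D = "dyck_paths (2 * n)" and ?T = "tamari_order (2 * n)"
  have \<nu>: "set (\<nu> @ [N]) \<subseteq> {N, E}" "length \<nu> = n - 1" "\<not> sublist [E, E] \<nu>"
    using assms(1) by (auto simp: EE_avoiding_words_def)
  have "\<not> sublist [E, E] (\<nu> @ [N])" using \<nu>(3) by (simp add: sublist_snoc)
  then obtain w where w: "\<nu> @ [N] = skeleton_type w" "E \<notin> set w"
    using EE_avoiding_eq_skeleton_type[of "\<nu> @ [N]"] \<nu>(1) by auto
  then have "w \<noteq> []" by auto
  then have low: "motzkin_path (lowest w)" using w(2) motzkin_path_lowest by blast
  moreover have "length (skeleton_type w) = n"
    using \<nu>(2) assms(2) unfolding w(1)[symmetric] by simp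
  then have "length (lowest w) = n"
    using length_full_type_expand[of "lowest w"] w(2) by (simp add: full_type_expand)
  ultimately have lowM: "lowest w \<in> motzkin_paths n" by (simp add: motzkin_paths_def)
  have skel: "skeleton (lowest w) = w" using w(2) by simp
  have between: "(lowest w, P) \<in> motzkin_order n" "(P, highest w) \<in> motzkin_order n"
    if "P \<in> motzkin_paths n" "skeleton P = w" for P
    using motzkin_between_extremal[OF that(1)] that(2) by auto
  \<comment> \<open>Membership is read off from the comparison with \<open>lowest w\<close>, so no
    heights have to be computed.\<close>
  have highM: "highest w \<in> motzkin_paths n"
    using between(2)[OF lowM skel] by (auto simp: motzkin_order_def rotation_order_def)
  have high_skel: "skeleton (highest w) = w"
    using between(2)[OF lowM skel] rtrancl_path_cover_skeleton[of "lowest w"] skel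
    by (auto simp: motzkin_order_def rotation_order_def)
  let ?a = "expand (lowest w)" and ?b = "expand (highest w)"
  have ab: "?a \<in> ?D" "?b \<in> ?D" using lowM highM expand_in_dyck_paths_iff by auto
  have type: "full_type ?a = \<nu> @ [N]" "full_type ?b = \<nu> @ [N]"
    by (simp_all add: full_type_expand skel high_skel w(1))
  have "dyck_paths_of_type (2 * n) \<nu> = {x \<in> ?D. (?a, x) \<in> ?T \<and> (x, ?b) \<in> ?T}"
  proof (intro set_eqI iffI)
    fix R assume R: "R \<in> dyck_paths_of_type (2 * n) \<nu>"
    then obtain P where P: "P \<in> motzkin_paths n" "R = expand P"
      using dyck_paths_of_type_expand[OF assms(1)] by blast
    moreover have "path_type R = \<nu>" "R \<in> ?D" using R by (auto simp: dyck_paths_of_type_def)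
    moreover from this have "skeleton_type (skeleton P) = skeleton_type w"
      using path_type_expand(1)[OF P(1)] P(2) w(1) by simp
    then have "skeleton P = w" by (rule skeleton_type_inj) (use w(2) in simp_all)
    ultimately show "R \<in> {x \<in> ?D. (?a, x) \<in> ?T \<and> (x, ?b) \<in> ?T}"
      using between motzkin_order_imp_tamari_order by blast
  next
    fix R assume R: "R \<in> {x \<in> ?D. (?a, x) \<in> ?T \<and> (x, ?b) \<in> ?T}"
    then have "(?a, R) \<in> ?T" "(R, ?b) \<in> ?T" by simp_all
    \<comment> \<open>Both end points have this type, and a change in between would strictly
      increase the number of letters \<open>E\<close>.\<close>
    then have "full_type R = \<nu> @ [N]"
      using tamari_order_full_type_le[of ?a R] tamari_order_full_type_le[of R ?b] type by fastforce
    then show "R \<in> dyck_paths_of_type (2 * n) \<nu>"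
      using R by (simp add: dyck_paths_of_type_def path_type_eq_full_type)
  qed
  moreover have "(?a, ?b) \<in> ?T"
    using between(2)[OF lowM skel] by (rule motzkin_order_imp_tamari_order)
  ultimately show ?thesis unfolding poset_interval_def using ab by blast
qed

section \<open>Disjoint unions and restrictions of partial orders\<close>

lemma partial_order_disjoint_union:
  assumes "\<And>i. i \<in> I \<Longrightarrow> partial_order_on (A i) (r i)"
  shows "partial_order_on (Sigma I A) (disjoint_union_order I r)"
proof -
  let ?u = "disjoint_union_order I r"
  have r: "r i \<subseteq> A i \<times> A i" "refl_on (A i) (r i)" "trans (r i)" "antisym (r i)" if "i \<in> I" for i
    using assms[OF that] by (auto simp: partial_order_on_def preorder_on_def)
  have "?u \<subseteq> Sigma I A \<times> Sigma I A"
    using r(1) by (auto simp: disjoint_union_order_def)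
  moreover have "refl_on (Sigma I A) ?u"
    using r(2) by (auto simp: disjoint_union_order_def refl_on_def)
  moreover have "trans ?u"
    using r(3) by (auto simp: disjoint_union_order_def intro!: transI dest: transD)
  moreover have "antisym ?u"
    using r(4) by (auto simp: disjoint_union_order_def intro!: antisymI dest: antisymD)
  ultimately show ?thesis by (simp add: partial_order_on_def preorder_on_def)
qed

lemma partial_order_Restr:
  assumes "partial_order_on A r" "B \<subseteq> A"
  shows "partial_order_on B (Restr r B)"
  using assms unfolding partial_order_on_def preorder_on_def
  by (auto simp: refl_on_def antisym_def intro: trans_Restr)

theorem corollary3p4:
  fixes n :: nat
  assumes "n \<ge> 1"
  shows "poset_iso
           (motzkin_paths n) (motzkin_order n)
           (SIGMA \<nu>:EE_avoiding_words (n - 1). dyck_paths_of_type (2 * n) \<nu>)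
           (disjoint_union_order (EE_avoiding_words (n - 1))
              (\<lambda>\<nu>. Restr (tamari_order (2 * n)) (dyck_paths_of_type (2 * n) \<nu>)))
           (\<lambda>P. (path_type (\<phi>_inv P), \<phi>_inv P)) \<and>
         (\<forall>\<nu>\<in>EE_avoiding_words (n - 1).
           poset_interval (dyck_paths (2 * n)) (tamari_order (2 * n))
             (dyck_paths_of_type (2 * n) \<nu>)) \<and>
         connected_components (motzkin_paths n) (motzkin_order n) =
           {{P \<in> motzkin_paths n. cls P = c} | c. c \<in> cls ` motzkin_paths n}"
proof (intro conjI ballI)
  let ?M = "motzkin_paths n" and ?W = "EE_avoiding_words (n - 1)"
  let ?S = "SIGMA \<nu>:?W. dyck_paths_of_type (2 * n) \<nu>"
  let ?r = "\<lambda>\<nu>. Restr (tamari_order (2 * n)) (dyck_paths_of_type (2 * n) \<nu>)"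
  let ?f = "\<lambda>P. (path_type (\<phi>_inv P), \<phi>_inv P)"
  have f: "?f P = (path_type (expand P), expand P)" if "P \<in> ?M" for P
    using that \<phi>_inv_eq_expand by (simp add: motzkin_paths_def)
  have mem: "expand P \<in> dyck_paths_of_type (2 * n) \<nu> \<longleftrightarrow> path_type (expand P) = \<nu>"
    if "P \<in> ?M" for P \<nu>
    using that expand_in_dyck_paths_iff by (simp add: dyck_paths_of_type_def)
  have "inj_on ?f ?M"
    using f expand_inj by (intro inj_onI) auto
  moreover have "?f ` ?M = ?S"
  proof (intro set_eqI iffI)
    fix x assume "x \<in> ?f ` ?M"
    then show "x \<in> ?S" using f mem path_type_expand(2) by auto
  next
    fix x assume "x \<in> ?S"
    then obtain \<nu> R where x: "x = (\<nu>, R)" "\<nu> \<in> ?W" "R \<in> dyck_paths_of_type (2 * n) \<nu>" by auto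
    then obtain P where P: "P \<in> ?M" "R = expand P" using dyck_paths_of_type_expand by blast
    then have "x = ?f P" using x f mem by simp
    then show "x \<in> ?f ` ?M" using P(1) by blast
  qed
  ultimately have "bij_betw ?f ?M ?S" by (simp add: bij_betw_def)
  \<comment> \<open>The index in the disjoint union is the type, so the equality of types in
    \<open>motzkin_order_iff_tamari_order\<close> says that both images lie in the same
    summand.\<close>
  moreover have "(P, Q) \<in> motzkin_order n \<longleftrightarrow> (?f P, ?f Q) \<in> disjoint_union_order ?W ?r"
    if "P \<in> ?M" "Q \<in> ?M" for P Q
    using that mem path_type_expand(2)
    by (auto simp: motzkin_order_iff_tamari_order disjoint_union_order_def f)
  moreover have "partial_order_on ?M (motzkin_order n)"
    unfolding motzkin_order_def by (rule partial_order_rotation_order)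
  moreover have "partial_order_on ?S (disjoint_union_order ?W ?r)"
  proof (rule partial_order_disjoint_union)
    fix \<nu> show "partial_order_on (dyck_paths_of_type (2 * n) \<nu>) (?r \<nu>)"
      using partial_order_rotation_order unfolding tamari_order_def
      by (rule partial_order_Restr) (auto simp: dyck_paths_of_type_def)
  qed
  ultimately show "poset_iso ?M (motzkin_order n) ?S (disjoint_union_order ?W ?r) ?f"
    unfolding poset_iso_def by blast
next
  fix \<nu> assume "\<nu> \<in> EE_avoiding_words (n - 1)"
  then show "poset_interval (dyck_paths (2 * n)) (tamari_order (2 * n)) (dyck_paths_of_type (2 * n) \<nu>)"
    using assms by (rule dyck_paths_of_type_interval)
next
  show "connected_components (motzkin_paths n) (motzkin_order n) =
      {{P \<in> motzkin_paths n. cls P = c} | c. c \<in> cls ` motzkin_paths n}"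
    by (rule connected_components_motzkin_order)
qed

end
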